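(* Let $n\ge 1$ and $\lambda=(n,n)$. Let $(a_{ST})_{S,T\in\mathcal{T}(n,n)}$ be the transitioning matrix defined by $\rho(v_T)=\sum_{S\in\mathcal{T}(n,n)}a_{ST}\,w_S$, where $\rho:S^{\lambda}\to W^{\lambda}$ is the $S_{2n}$-module isomorphism normalized by $\rho(v_{T_0})=w_{T_0}$. Then for all $S,T\in\mathcal{T}(n,n)$, $a_{ST}>0$ if and only if $S\leq T$.
   Context: All vector spaces are over $\mathbb{C}$; $s_i=(i\ \ i+1)$, $1\le i\le 2n-1$, are the simple transpositions of $S_{2n}$, and $\lambda=(n,n)$ is the two-row partition of $2n$. Tableaux. $\mathcal{T}(n,n)$ is the set of standard Young tableaux of shape $(n,n)$ (two rows of length $n$, filled bijectively with $1,\dots,2n$, increasing along rows and down columns). $S_{2n}$ acts on tableaux by acting on entries. $T_0\in\mathcal{T}(n,n)$ is the tableau with $1,2,\dots,2n$ placed down successive columns (columns $(1,2),(3,4),\dots,(2n-1,2n)$). Specht module. $S^\lambda$ is the Specht module with its polytabloids $v_T$ ($T$ a tableau of shape $\lambda$), $v_T=\sum_{\sigma}\operatorname{sgn}(\sigma)\{\sigma T\}$, where $\sigma$ runs over the column stabilizer of $T$ and $\{\cdot\}$ denotes the tabloid (row-equivalence class); thus $\sigma.v_T=v_{\sigma.T}$ for $\sigma\in S_{2n}$, and $s_i.v_T=-v_T$ if $i,i+1$ are in the same column of $T$. The $v_T$ with $T\in\mathcal{T}(n,n)$ form a basis of $S^\lambda$. Webs. A cup diagram (web) on $2n$ dots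 labeled $1,\dots,2n$ from left to right on a horizontal axis is a noncrossing perfect matching of the dots, with arcs drawn below the axis. $W^\lambda$ is the $\mathbb{C}$-vector space with basis the set of cup diagrams. $S_{2n}$ acts on it by: $s_i.w=-w$ if $i$ and $i+1$ are joined by an arc of $w$; otherwise $s_i.w=w+w'$, where $w'$ is the cup diagram obtained from $w$ by replacing the two arcs incident to $i$ and to $i+1$ by the arc joining $i$ and $i+1$ and the arc joining the former partners of $i$ and $i+1$. Bijection. For $T\in\mathcal{T}(n,n)$, $w_T=\phi(T)$ is the unique cup diagram whose set of left endpoints of arcs is the set of entries of the first row of $T$; $\phi$ is a bijection from $\mathcal{T}(n,n)$ to cup diagrams. Isomorphism. $S^\lambda$ and $W^\lambda$ are isomorphic irreducible $S_{2n}$-modules, and $\rho$ is the unique $S_{2n}$-isomorphism $S^\lambda\to W^\lambda$ with $\rho(v_{T_0})=w_{T_0}$. Partial order. The tableau graph is the directed graph with vertex set $\mathcal{T}(n,n)$ and a directed edge $T\to R$ (labeled $s_i$) whenever $R=s_i.T$ for some $i$ such that $i$ is in a row underneath $i+1$ in $T$ (i.e. $i$ is in the second row and $i+1$ in the first row). For $S,T\in\mathcal{T}(n,n)$, $S\le T$ means that there is a directed path (possibly of length zero) from $S$ to $T$. *)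

theory Defs
  imports
    Complex_Main
    "HOL-Combinatorics.Permutations"
    "HOL-Library.Disjoint_Sets"
    "HOL-Library.Function_Algebras"
    "HOL-Library.Complex_Order"
begin
text \<open>
  All modules are subspaces of spaces of functions from some index type into the complex numbers,
  with pointwise addition (from \<^theory>\<open>HOL-Library.Function_Algebras\<close>) and the scalar
  multiplication below.
\<close>

definition cscale :: "complex \<Rightarrow> ('b \<Rightarrow> complex) \<Rightarrow> ('b \<Rightarrow> complex)" where
  "cscale c f = (\<lambda>x. c * f x)"

interpretation cfun: vector_space "cscale :: complex \<Rightarrow> ('b \<Rightarrow> complex) \<Rightarrow> ('b \<Rightarrow> complex)"
  by unfold_locales (auto simp: cscale_def plus_fun_def algebra_simps)

definition delta :: "'b \<Rightarrow> 'b \<Rightarrow> complex" where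
  "delta b = (\<lambda>x. if x = b then 1 else 0)"

definition linear_between ::
  "('b \<Rightarrow> complex) set \<Rightarrow> ('c \<Rightarrow> complex) set \<Rightarrow> (('b \<Rightarrow> complex) \<Rightarrow> ('c \<Rightarrow> complex)) \<Rightarrow> bool" where
  "linear_between V W f \<longleftrightarrow>
     (\<forall>x\<in>V. f x \<in> W) \<and>
     (\<forall>x\<in>V. \<forall>y\<in>V. f (x + y) = f x + f y) \<and>
     (\<forall>c. \<forall>x\<in>V. f (cscale c x) = cscale c (f x))"

text \<open>
  The symmetric group on \<open>m\<close> letters consists of the \<open>\<sigma> :: nat \<Rightarrow> nat\<close> with
  \<open>\<sigma> permutes {1..m}\<close>; products are composed from right to left, and actions are left actions.
\<close>

abbreviation simple_transp :: "nat \<Rightarrow> nat \<Rightarrow> nat" where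
  "simple_transp i \<equiv> Transposition.transpose i (i + 1)"

definition sym_module ::
  "nat \<Rightarrow> ('b \<Rightarrow> complex) set \<Rightarrow> ((nat \<Rightarrow> nat) \<Rightarrow> ('b \<Rightarrow> complex) \<Rightarrow> ('b \<Rightarrow> complex)) \<Rightarrow> bool" where
  "sym_module m V act \<longleftrightarrow>
     (\<forall>\<sigma>. \<sigma> permutes {1..m} \<longrightarrow> linear_between V V (act \<sigma>)) \<and>
     (\<forall>x\<in>V. act id x = x) \<and>
     (\<forall>\<sigma> \<tau>. \<sigma> permutes {1..m} \<longrightarrow> \<tau> permutes {1..m} \<longrightarrow>
        (\<forall>x\<in>V. act (\<sigma> \<circ> \<tau>) x = act \<sigma> (act \<tau> x)))"

definition sym_module_iso ::
  "nat \<Rightarrow> ('b \<Rightarrow> complex) set \<Rightarrow> ((nat \<Rightarrow> nat) \<Rightarrow> ('b \<Rightarrow> complex) \<Rightarrow> ('b \<Rightarrow> complex)) \<Rightarrow>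
   ('c \<Rightarrow> complex) set \<Rightarrow> ((nat \<Rightarrow> nat) \<Rightarrow> ('c \<Rightarrow> complex) \<Rightarrow> ('c \<Rightarrow> complex)) \<Rightarrow>
   (('b \<Rightarrow> complex) \<Rightarrow> ('c \<Rightarrow> complex)) \<Rightarrow> bool" where
  "sym_module_iso m V actV W actW \<rho> \<longleftrightarrow>
     linear_between V W \<rho> \<and> bij_betw \<rho> V W \<and>
     (\<forall>\<sigma>. \<sigma> permutes {1..m} \<longrightarrow> (\<forall>x\<in>V. \<rho> (actV \<sigma> x) = actW \<sigma> (\<rho> x)))"

text \<open>
  A tableau is the pair of its rows (first row, second row), so its \<open>j\<close>-th column consists of the
  \<open>j\<close>-th entries of the two lists.
\<close>

type_synonym tableau = "nat list \<times> nat list"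

definition tableaux :: "nat \<Rightarrow> tableau set" where
  "tableaux n = {T. length (fst T) = n \<and> length (snd T) = n \<and>
     distinct (fst T @ snd T) \<and> set (fst T @ snd T) = {1..2 * n}}"

definition standard_tableaux :: "nat \<Rightarrow> tableau set" where
  "standard_tableaux n = {T \<in> tableaux n. sorted_wrt (<) (fst T) \<and> sorted_wrt (<) (snd T) \<and>
     (\<forall>j<n. fst T ! j < snd T ! j)}"

definition tab_act :: "(nat \<Rightarrow> nat) \<Rightarrow> tableau \<Rightarrow> tableau" where
  "tab_act \<sigma> = map_prod (map \<sigma>) (map \<sigma>)"

definition T0 :: "nat \<Rightarrow> tableau" where
  "T0 n = (map (\<lambda>j. 2 * j + 1) [0..<n], map (\<lambda>j. 2 * j + 2) [0..<n])"

type_synonym tabloid = "tableau set"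

definition tabloid :: "nat \<Rightarrow> tableau \<Rightarrow> tabloid" where
  "tabloid n T = {R \<in> tableaux n. set (fst R) = set (fst T) \<and> set (snd R) = set (snd T)}"

definition column_stabilizer :: "nat \<Rightarrow> tableau \<Rightarrow> (nat \<Rightarrow> nat) set" where
  "column_stabilizer n T = {\<sigma>. \<sigma> permutes {1..2 * n} \<and>
     (\<forall>j<n. \<sigma> ` {fst T ! j, snd T ! j} = {fst T ! j, snd T ! j})}"

definition polytabloid :: "nat \<Rightarrow> tableau \<Rightarrow> tabloid \<Rightarrow> complex" where
  "polytabloid n T =
     (\<Sum>\<sigma>\<in>column_stabilizer n T. cscale (of_int (sign \<sigma>)) (delta (tabloid n (tab_act \<sigma> T))))"

definition specht :: "nat \<Rightarrow> (tabloid \<Rightarrow> complex) set" where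
  "specht n = cfun.span (polytabloid n ` tableaux n)"

text \<open>
  The linear extension of \<open>{T} \<mapsto> {\<sigma>T}\<close>: the coefficient of \<open>\<sigma>f\<close> at a tabloid \<open>X\<close> is the
  coefficient of \<open>f\<close> at the translate of \<open>X\<close> by the inverse of \<open>\<sigma>\<close>.
\<close>

definition specht_act :: "(nat \<Rightarrow> nat) \<Rightarrow> (tabloid \<Rightarrow> complex) \<Rightarrow> (tabloid \<Rightarrow> complex)" where
  "specht_act \<sigma> f = (\<lambda>X. f (tab_act (inv \<sigma>) ` X))"

text \<open>A cup diagram is the set of its arcs, an arc being the set of its two end points.\<close>

type_synonym web = "nat set set"

definition cup_diagrams :: "nat \<Rightarrow> web set" where
  "cup_diagrams n = {w. partition_on {1..2 * n} w \<and> (\<forall>e\<in>w. card e = 2) \<and>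
     \<not> (\<exists>a b c d. a < b \<and> b < c \<and> c < d \<and> {a, c} \<in> w \<and> {b, d} \<in> w)}"

definition left_endpoints :: "web \<Rightarrow> nat set" where
  "left_endpoints w = {a. \<exists>b. a < b \<and> {a, b} \<in> w}"

definition partner :: "web \<Rightarrow> nat \<Rightarrow> nat" where
  "partner w i = (THE j. {i, j} \<in> w)"

definition web_switch :: "nat \<Rightarrow> web \<Rightarrow> web" where
  "web_switch i w =
     (w - {{i, partner w i}, {i + 1, partner w (i + 1)}}) \<union>
     {{i, i + 1}, {partner w i, partner w (i + 1)}}"

definition web_module :: "nat \<Rightarrow> (web \<Rightarrow> complex) set" where
  "web_module n = cfun.span (delta ` cup_diagrams n)"

text \<open>
  An action on the web module is prescribed by the values of the simple transpositions on the
  basis.  Since these generate the symmetric group, at most one action (up to its values outside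
  the module and on non-permutations) satisfies this predicate.
\<close>

definition web_action ::
  "nat \<Rightarrow> ((nat \<Rightarrow> nat) \<Rightarrow> (web \<Rightarrow> complex) \<Rightarrow> (web \<Rightarrow> complex)) \<Rightarrow> bool" where
  "web_action n act \<longleftrightarrow> sym_module (2 * n) (web_module n) act \<and>
     (\<forall>i\<in>{1..2 * n - 1}. \<forall>w\<in>cup_diagrams n.
        act (simple_transp i) (delta w) =
          (if {i, i + 1} \<in> w then - delta w else delta w + delta (web_switch i w)))"

definition tab_web :: "nat \<Rightarrow> tableau \<Rightarrow> web" where
  "tab_web n T = (THE w. w \<in> cup_diagrams n \<and> left_endpoints w = set (fst T))"

definition tableau_graph :: "nat \<Rightarrow> (tableau \<times> tableau) set" where
  "tableau_graph n = {(T, R). T \<in> standard_tableaux n \<and> R \<in> standard_tableaux n \<and>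
     (\<exists>i\<in>{1..2 * n - 1}. i \<in> set (snd T) \<and> i + 1 \<in> set (fst T) \<and>
        R = tab_act (simple_transp i) T)}"

definition tableau_le :: "nat \<Rightarrow> tableau \<Rightarrow> tableau \<Rightarrow> bool" where
  "tableau_le n S T \<longleftrightarrow> (S, T) \<in> (tableau_graph n)\<^sup>*"

end

(*
  As a function of the tabloid X, the polytabloid of a tableau T is the product over the columns
  (t, b) of x_t - x_b, where x is the indicator function of the first row of X.  It therefore
  depends only on the matching formed by the columns of T, and the Plucker relation
  (x_a - x_c)(x_b - x_d) = (x_a - x_b)(x_c - x_d) + (x_a - x_d)(x_b - x_c) resolves a crossing of
  this matching into a sum of two matchings.  The isomorphism sends the product of a cup diagram to
  the corresponding basis web: this holds for the web of T0, and it propagates along the edges of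
  the tableau graph because the simple transpositions act by the same rule on both sides.  Hence
  the coefficients are nonnegative.

  One resolution of a crossing keeps the set of left end points, the other one lowers its lattice
  path, so only webs below T occur in the expansion for T, and the web of T does occur.  Along an
  edge from T to R the expansion for R is the one for T plus nonnegative terms, so every S below T
  contributes.  Finally, a path lying below another one is raised to it by edges of the tableau
  graph, at each step at a lowest point among those where the two paths differ.
*)
theory Submission
  imports Defs
begin

section \<open>Perfect matchings\<close>

text \<open>Crossings are allowed here: the columns of a tableau may cross, and the crossings are
  resolved one at a time.\<close>

definition matchings :: "nat \<Rightarrow> web set" where
  "matchings n = {m. partition_on {1..2 * n} m \<and> (\<forall>e\<in>m. card e = 2)}"

lemma cup_diagrams_eq:
  "cup_diagrams n =
     {m \<in> matchings n. \<not> (\<exists>a b c d. a < b \<and> b < c \<and> c < d \<and> {a, c} \<in> m \<and> {b, d} \<in> m)}"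
  by (auto simp: cup_diagrams_def matchings_def)

lemma finite_matching: "m \<in> matchings n \<Longrightarrow> finite m"
  using finite_elements by (auto simp: matchings_def)

lemma arc_disjoint:
  assumes "m \<in> matchings n" "e \<in> m" "e' \<in> m" "x \<in> e" "x \<in> e'"
  shows "e = e'"
  using assms by (auto simp: matchings_def partition_on_def disjoint_def)

lemma arc_obtain:
  assumes "m \<in> matchings n" "e \<in> m"
  obtains a b where "e = {a, b}" "a < b" "1 \<le> a" "b \<le> 2 * n"
proof -
  have "card e = 2" and sub: "e \<subseteq> {1..2 * n}"
    using assms by (auto simp: matchings_def partition_on_def)
  then obtain a b where ab: "e = {a, b}" "a \<noteq> b"
    by (auto simp: card_2_iff)
  show ?thesis
  proof (cases "a < b")
    case True
    then show ?thesis using ab sub that[of a b] by auto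
  next
    case False
    then show ?thesis using ab sub that[of b a] by (auto simp: insert_commute)
  qed
qed

lemma arc_range:
  assumes "m \<in> matchings n" "{x, y} \<in> m"
  shows "x \<in> {1..2 * n}" "y \<in> {1..2 * n}" "x \<noteq> y"
proof -
  have "card {x, y} = 2" "{x, y} \<subseteq> {1..2 * n}"
    using assms by (auto simp: matchings_def partition_on_def)
  then show "x \<in> {1..2 * n}" "y \<in> {1..2 * n}" "x \<noteq> y"
    by auto
qed

lemma arc_unique:
  assumes "m \<in> matchings n" "{x, y} \<in> m" "{x, z} \<in> m"
  shows "y = z"
  using arc_disjoint[OF assms(1,2,3), of x] arc_range(3)[OF assms(1,2)]
  by (auto simp: doubleton_eq_iff)

lemma arc_exists:
  assumes "m \<in> matchings n" "x \<in> {1..2 * n}"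
  obtains y where "{x, y} \<in> m"
proof -
  have "x \<in> \<Union>m"
    using assms by (simp add: matchings_def partition_on_def)
  then obtain e where "e \<in> m" "x \<in> e"
    by blast
  moreover obtain a b where "e = {a, b}"
    using arc_obtain[OF assms(1) \<open>e \<in> m\<close>] by metis
  ultimately have "{x, a} \<in> m \<or> {x, b} \<in> m"
    by (auto simp: insert_commute)
  then show ?thesis
    using that by blast
qed

lemma partner_eq:
  assumes "m \<in> matchings n" "{x, y} \<in> m"
  shows "partner m x = y"
  unfolding partner_def using assms(2) arc_unique[OF assms(1) _ assms(2)] by (rule the_equality)

lemma mem_left_endpoints:
  assumes "m \<in> matchings n" "{x, y} \<in> m"
  shows "x \<in> left_endpoints m \<longleftrightarrow> x < y"
  unfolding left_endpoints_def using assms(2) arc_unique[OF assms] by blast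

lemma left_endpoints_subset: "m \<in> matchings n \<Longrightarrow> left_endpoints m \<subseteq> {1..2 * n}"
  using arc_range(1) by (auto simp: left_endpoints_def simp del: atLeastAtMost_iff)

lemma left_endpoints_eq_Min:
  assumes "m \<in> matchings n"
  shows "left_endpoints m = Min ` m"
proof
  show "left_endpoints m \<subseteq> Min ` m"
    by (force simp: left_endpoints_def image_iff)
  have "Min e \<in> left_endpoints m" if e: "e \<in> m" for e
  proof -
    obtain a b where "e = {a, b}" "a < b"
      using arc_obtain[OF assms e] by blast
    then show ?thesis
      using mem_left_endpoints[OF assms] e by (simp add: min_def)
  qed
  then show "Min ` m \<subseteq> left_endpoints m"
    by blast
qed

lemma Min_arc: "m \<in> matchings n \<Longrightarrow> e \<in> m \<Longrightarrow> Min e \<in> e"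
  by (erule arc_obtain) auto

lemma Max_arc: "m \<in> matchings n \<Longrightarrow> e \<in> m \<Longrightarrow> Max e \<in> e"
  by (erule arc_obtain) auto

lemma inj_on_Min: "m \<in> matchings n \<Longrightarrow> inj_on Min m"
  by (rule inj_onI) (metis arc_disjoint Min_arc)

lemma inj_on_Max: "m \<in> matchings n \<Longrightarrow> inj_on Max m"
  by (rule inj_onI) (metis arc_disjoint Max_arc)

lemma Max_image_matching:
  assumes m: "m \<in> matchings n"
  shows "Max ` m = {1..2 * n} - left_endpoints m"
proof
  have "Max e \<in> {1..2 * n} - left_endpoints m" if e: "e \<in> m" for e
  proof -
    obtain a b where ab: "e = {a, b}" "a < b" "1 \<le> a" "b \<le> 2 * n"
      using arc_obtain[OF m e] .
    then show ?thesis
      using mem_left_endpoints[OF m, of b a] e by (auto simp: insert_commute)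
  qed
  then show "Max ` m \<subseteq> {1..2 * n} - left_endpoints m"
    by blast
next
  show "{1..2 * n} - left_endpoints m \<subseteq> Max ` m"
  proof
    fix x assume x: "x \<in> {1..2 * n} - left_endpoints m"
    then obtain y where y: "{x, y} \<in> m"
      using arc_exists[OF m] by blast
    then have "x = Max {x, y}"
      using x mem_left_endpoints[OF m y] by auto
    with y show "x \<in> Max ` m"
      by blast
  qed
qed

lemma card_matching:
  assumes m: "m \<in> matchings n"
  shows "card m = n"
proof -
  have "sum card m = card (\<Union>m)"
    by (rule card_Union_disjoint[symmetric])
      (use m in \<open>auto simp: matchings_def partition_on_def intro: card_ge_0_finite\<close>)
  then have "2 * card m = 2 * n"
    using m by (simp add: matchings_def partition_on_def)
  then show ?thesis
    by simp
qed

lemma card_left_endpoints: "m \<in> matchings n \<Longrightarrow> card (left_endpoints m) = n"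
  by (simp add: left_endpoints_eq_Min card_image inj_on_Min card_matching)

text \<open>Serves both resolutions of a crossing and the web switch: each trades two arcs for two
  others on the same four points. The last three conclusions are the side conditions of
  \<open>rewire\<close>.\<close>

lemma matching_rewire:
  assumes m: "m \<in> matchings n" and e: "e1 \<in> m" "e2 \<in> m"
    and f: "e3 \<union> e4 = e1 \<union> e2" "e3 \<inter> e4 = {}" "card e3 = 2" "card e4 = 2"
  shows "(m - {e1, e2}) \<union> {e3, e4} \<in> matchings n"
    and "e3 \<noteq> e4" and "e3 \<notin> m - {e1, e2}" and "e4 \<notin> m - {e1, e2}"
proof -
  have dis: "e \<inter> (e3 \<union> e4) = {}" if "e \<in> m - {e1, e2}" for e
    unfolding f(1) using that arc_disjoint[OF m _ e(1)] arc_disjoint[OF m _ e(2)] by blast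
  have ne: "e3 \<noteq> {}" "e4 \<noteq> {}"
    using f by auto
  then show "e3 \<noteq> e4" using f(2) by auto
  show "e3 \<notin> m - {e1, e2}" "e4 \<notin> m - {e1, e2}"
    using dis[of e3] dis[of e4] ne by auto
  let ?m = "(m - {e1, e2}) \<union> {e3, e4}"
  have "\<Union>?m = \<Union>(m - {e1, e2}) \<union> (e1 \<union> e2)"
    using f(1) by auto
  also have "\<dots> = \<Union>m"
    using e by auto
  finally have "\<Union>?m = {1..2 * n}"
    using m by (simp add: matchings_def partition_on_def)
  moreover have "disjoint ?m"
  proof -
    have "disjoint (m - {e1, e2})"
      using m by (auto simp: matchings_def partition_on_def intro: pairwise_subset)
    then show ?thesis
      using dis f(2) by (auto simp: pairwise_insert disjnt_def)
  qed
  moreover have "{} \<notin> ?m"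
    using m ne by (auto simp: matchings_def partition_on_def)
  ultimately show "?m \<in> matchings n"
    using m f unfolding matchings_def partition_on_def by auto
qed

text \<open>Stated for any commutative monoid, as it is applied to the products
  \<open>matching_poly\<close> and to the sums of \<open>arc_weight\<close>.\<close>

lemma (in comm_monoid_set) rewire:
  assumes "finite m" "e1 \<in> m" "e2 \<in> m" "e1 \<noteq> e2"
    and "e3 \<noteq> e4" "e3 \<notin> m - {e1, e2}" "e4 \<notin> m - {e1, e2}"
  shows "F g m = f (f (g e1) (g e2)) (F g (m - {e1, e2}))"
    and "F g ((m - {e1, e2}) \<union> {e3, e4}) = f (f (g e3) (g e4)) (F g (m - {e1, e2}))"
proof -
  have "m = insert e1 (insert e2 (m - {e1, e2}))"
    using assms by auto
  then have "F g m = F g (insert e1 (insert e2 (m - {e1, e2})))"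
    by simp
  also have "\<dots> = f (f (g e1) (g e2)) (F g (m - {e1, e2}))"
    using assms by (subst insert; simp add: assoc)
  finally show "F g m = f (f (g e1) (g e2)) (F g (m - {e1, e2}))" .
  have "(m - {e1, e2}) \<union> {e3, e4} = insert e3 (insert e4 (m - {e1, e2}))"
    by auto
  then have "F g ((m - {e1, e2}) \<union> {e3, e4}) = F g (insert e3 (insert e4 (m - {e1, e2})))"
    by simp
  also have "\<dots> = f (f (g e3) (g e4)) (F g (m - {e1, e2}))"
    using assms by (subst insert; simp add: assoc)
  finally show "F g ((m - {e1, e2}) \<union> {e3, e4}) = f (f (g e3) (g e4)) (F g (m - {e1, e2}))" .
qed

text \<open>Read from left to right, a right end point must close the nearest open left end point,
  so the arcs are forced; the induction is on the right end point.\<close>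

lemma cup_diagram_eqI:
  assumes w: "w \<in> cup_diagrams n" and w': "w' \<in> cup_diagrams n"
    and L: "left_endpoints w = left_endpoints w'"
  shows "w = w'"
proof -
  have m: "w \<in> matchings n" and m': "w' \<in> matchings n"
    using w w' by (auto simp: cup_diagrams_eq)
  \<comment> \<open>If \<open>b\<close> is closed by different points, the arc of \<open>v\<close>
    from the inner point \<open>a'\<close> is enclosed by \<open>{a, b}\<close>, so it ends before
    \<open>b\<close> and by induction belongs to \<open>v'\<close>, where \<open>a'\<close> is
    already joined to \<open>b\<close>.\<close>
  have step: False
    if v: "v \<in> cup_diagrams n" and v': "v' \<in> cup_diagrams n"
      and L: "left_endpoints v = left_endpoints v'"
      and arcs: "{a, b} \<in> v" "{a', b} \<in> v'" "a < a'" "a' < b"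
      and IH: "\<And>c x. c < b \<Longrightarrow> x < c \<Longrightarrow> {x, c} \<in> v \<Longrightarrow> {x, c} \<in> v'" for v v' a a' b
  proof -
    have mv: "v \<in> matchings n" and mv': "v' \<in> matchings n"
      using v v' by (auto simp: cup_diagrams_eq)
    obtain c where c: "{a', c} \<in> v"
      using arc_exists[OF mv, of a'] arc_range(1)[OF mv' arcs(2)] by blast
    have "a' \<in> left_endpoints v"
      using mem_left_endpoints[OF mv' arcs(2)] arcs(4) L by simp
    then have ac: "a' < c"
      using mem_left_endpoints[OF mv c] by simp
    have "c \<noteq> b"
      using arc_unique[OF mv, of b a a'] arcs c by (auto simp: insert_commute)
    moreover have "\<not> b < c"
      using v arcs c by (auto simp: cup_diagrams_eq)
    ultimately have "{a', c} \<in> v'"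
      using IH[OF _ ac c] by simp
    with arcs(2) \<open>c \<noteq> b\<close> show False
      using arc_unique[OF mv'] by blast
  qed
  have main: "x < b \<Longrightarrow> ({x, b} \<in> w \<longrightarrow> {x, b} \<in> w') \<and> ({x, b} \<in> w' \<longrightarrow> {x, b} \<in> w)" for x b
  proof (induction b arbitrary: x rule: less_induct)
    case (less b)
    \<comment> \<open>Kept general in \<open>v\<close> and \<open>v'\<close> so that exchanging the
      two diagrams yields the other inclusion.\<close>
    have one: "{x, b} \<in> v'"
      if v: "v \<in> cup_diagrams n" and v': "v' \<in> cup_diagrams n"
        and L: "left_endpoints v = left_endpoints v'" and x: "{x, b} \<in> v"
        and IH: "\<And>c x. c < b \<Longrightarrow> x < c \<Longrightarrow> {x, c} \<in> v \<Longrightarrow> {x, c} \<in> v'"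
        and IH': "\<And>c x. c < b \<Longrightarrow> x < c \<Longrightarrow> {x, c} \<in> v' \<Longrightarrow> {x, c} \<in> v" for v v'
    proof -
      have mv: "v \<in> matchings n" and mv': "v' \<in> matchings n"
        using v v' by (auto simp: cup_diagrams_eq)
      obtain y where y: "{b, y} \<in> v'"
        using arc_exists[OF mv', of b] arc_range(2)[OF mv x] by blast
      have "b \<notin> left_endpoints v"
        using mem_left_endpoints[OF mv, of b x] x less.prems by (simp add: insert_commute)
      then have "\<not> b < y" "y \<noteq> b"
        using mem_left_endpoints[OF mv' y] arc_range(3)[OF mv' y] L by auto
      then have yb: "y < b" by simp
      have y': "{y, b} \<in> v'"
        using y by (simp add: insert_commute)
      have "\<not> x < y"
        using step[OF v v' L x y' _ yb IH] by blast
      moreover have "\<not> y < x"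
        using step[OF v' v L[symmetric] y' x _ less.prems IH'] by blast
      ultimately show ?thesis
        using y' by (metis nat_neq_iff)
    qed
    show ?case
      using one[OF w w' L] one[OF w' w L[symmetric]] less.IH by blast
  qed
  show ?thesis
  proof (rule set_eqI)
    fix e
    show "e \<in> w \<longleftrightarrow> e \<in> w'"
      using main by (metis arc_obtain[OF m, of e] arc_obtain[OF m', of e])
  qed
qed

lemma tab_web_eq:
  assumes "w \<in> cup_diagrams n" "left_endpoints w = set (fst T)"
  shows "tab_web n T = w"
  unfolding tab_web_def using assms by (intro the_equality) (metis cup_diagram_eqI)+

section \<open>Polytabloids\<close>

lemma tableau_distinct:
  assumes "T \<in> tableaux n" "i < n" "j < n"
  shows "fst T ! i = fst T ! j \<longleftrightarrow> i = j" and "snd T ! i = snd T ! j \<longleftrightarrow> i = j"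
    and "fst T ! i \<noteq> snd T ! j" and "snd T ! j \<noteq> fst T ! i"
proof -
  have "fst T ! i \<in> set (fst T)" "snd T ! j \<in> set (snd T)"
    using assms by (auto simp: tableaux_def)
  moreover have "set (fst T) \<inter> set (snd T) = {}"
    using assms by (auto simp: tableaux_def)
  ultimately show "fst T ! i \<noteq> snd T ! j" "snd T ! j \<noteq> fst T ! i"
    by (metis disjoint_iff)+
qed (use assms in \<open>auto simp: tableaux_def nth_eq_iff_index_eq\<close>)

lemma tableau_rows:
  assumes "T \<in> tableaux n"
  shows "set (fst T) = (\<lambda>j. fst T ! j) ` {..<n}" "set (snd T) = (\<lambda>j. snd T ! j) ` {..<n}"
    "set (snd T) = {1..2 * n} - set (fst T)" "set (fst T) \<union> set (snd T) = {1..2 * n}"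
    "card (set (fst T)) = n"
proof -
  have len: "length (fst T) = n" "length (snd T) = n" and d: "distinct (fst T)"
    and un: "set (fst T) \<union> set (snd T) = {1..2 * n}" and dis: "set (fst T) \<inter> set (snd T) = {}"
    using assms by (auto simp: tableaux_def)
  show "set (fst T) = (\<lambda>j. fst T ! j) ` {..<n}" "set (snd T) = (\<lambda>j. snd T ! j) ` {..<n}"
    using len by (auto simp: set_conv_nth)
  show "set (snd T) = {1..2 * n} - set (fst T)" "set (fst T) \<union> set (snd T) = {1..2 * n}"
    using un dis by blast+
  show "card (set (fst T)) = n"
    using len d by (simp add: distinct_card)
qed

lemma tableau_entry:
  assumes "T \<in> tableaux n" "x \<in> {1..2 * n}"
  obtains j where "j < n" "x = fst T ! j \<or> x = snd T ! j"
  using assms tableau_rows(1,2,4)[OF assms(1)] by blast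

lemma tableau_entry_range:
  assumes "T \<in> tableaux n" "j < n"
  shows "fst T ! j \<in> {1..2 * n}" "snd T ! j \<in> {1..2 * n}"
  using assms tableau_rows(1,2,4)[OF assms(1)] by blast+

lemma tab_act_tableaux:
  assumes "T \<in> tableaux n" "\<sigma> permutes {1..2 * n}"
  shows "tab_act \<sigma> T \<in> tableaux n"
proof -
  have inj: "inj \<sigma>"
    using assms(2) permutes_inj by blast
  have "set (fst (tab_act \<sigma> T) @ snd (tab_act \<sigma> T)) = \<sigma> ` set (fst T @ snd T)"
    by (auto simp: tab_act_def)
  also have "\<dots> = {1..2 * n}"
    using assms permutes_image by (auto simp: tableaux_def)
  finally have *: "set (fst (tab_act \<sigma> T) @ snd (tab_act \<sigma> T)) = {1..2 * n}" .
  have "fst (tab_act \<sigma> T) @ snd (tab_act \<sigma> T) = map \<sigma> (fst T @ snd T)"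
    by (simp add: tab_act_def)
  then have "distinct (fst (tab_act \<sigma> T) @ snd (tab_act \<sigma> T))"
    using assms(1) inj by (simp only: distinct_map) (auto simp: tableaux_def inj_on_def)
  then show ?thesis
    using assms(1) * by (simp add: tableaux_def) (simp add: tab_act_def)
qed

lemma tab_act_nth:
  assumes "T \<in> tableaux n" "j < n"
  shows "fst (tab_act \<sigma> T) ! j = \<sigma> (fst T ! j)" "snd (tab_act \<sigma> T) ! j = \<sigma> (snd T ! j)"
  using assms by (auto simp: tab_act_def tableaux_def)

lemma set_tab_act:
  "set (fst (tab_act \<sigma> T)) = \<sigma> ` set (fst T)" "set (snd (tab_act \<sigma> T)) = \<sigma> ` set (snd T)"
  by (auto simp: tab_act_def)

text \<open>On each column an element either fixes or exchanges the two entries, so the set of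
  exchanged columns determines it.\<close>

lemma column_stabilizer_ext:
  assumes T: "T \<in> tableaux n"
    and s: "\<sigma> \<in> column_stabilizer n T" and t: "\<tau> \<in> column_stabilizer n T"
    and eq: "{j \<in> {..<n}. \<sigma> (fst T ! j) = snd T ! j} = {j \<in> {..<n}. \<tau> (fst T ! j) = snd T ! j}"
  shows "\<sigma> = \<tau>"
proof
  fix x
  show "\<sigma> x = \<tau> x"
  proof (cases "x \<in> {1..2 * n}")
    case False
    then show ?thesis
      using s t by (auto simp: column_stabilizer_def permutes_def)
  next
    case True
    then obtain j where j: "j < n" and x: "x = fst T ! j \<or> x = snd T ! j"
      using tableau_entry[OF T] by blast
    let ?u = "fst T ! j" and ?v = "snd T ! j"
    have ne: "?u \<noteq> ?v"
      using tableau_distinct[OF T j j] by simp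
    have val: "(\<rho> ?u = ?u \<and> \<rho> ?v = ?v) \<or> (\<rho> ?u = ?v \<and> \<rho> ?v = ?u)"
      if "\<rho> \<in> column_stabilizer n T" for \<rho>
    proof -
      have "\<rho> ` {?u, ?v} = {?u, ?v}" "\<rho> ?u \<noteq> \<rho> ?v"
        using that j ne by (auto simp: column_stabilizer_def dest: permutes_inj injD)
      then show ?thesis
        by (simp add: doubleton_eq_iff)
    qed
    have "\<sigma> ?u = ?v \<longleftrightarrow> \<tau> ?u = ?v"
      using eq j by blast
    then show ?thesis
      using val[OF s] val[OF t] ne x by metis
  qed
qed

text \<open>Compose one transposition for each column in \<open>J\<close>; each contributes a factor
  -1 to the sign. With \<open>column_stabilizer_ext\<close> this identifies the stabilizer with the
  subsets of \<open>{..<n}\<close>.\<close>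

lemma column_stabilizer_exists:
  assumes T: "T \<in> tableaux n" and "finite J" "J \<subseteq> {..<n}"
  shows "\<exists>\<sigma> \<in> column_stabilizer n T.
    {j \<in> {..<n}. \<sigma> (fst T ! j) = snd T ! j} = J \<and> sign \<sigma> = (- 1) ^ card J"
  using assms(2,3)
proof (induction J rule: finite_induct)
  case empty
  have "id \<in> column_stabilizer n T"
    by (simp add: column_stabilizer_def permutes_id)
  then show ?case
    using tableau_distinct[OF T] by (intro bexI[of _ id]) auto
next
  case (insert k J)
  then obtain \<sigma> where \<sigma>: "\<sigma> \<in> column_stabilizer n T"
    and J: "{j \<in> {..<n}. \<sigma> (fst T ! j) = snd T ! j} = J" and sgn: "sign \<sigma> = (- 1) ^ card J"
    by auto
  have k: "k < n" using insert by auto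
  let ?u = "fst T ! k" and ?v = "snd T ! k"
  let ?t = "Transposition.transpose ?u ?v"
  have ne: "?u \<noteq> ?v"
    using tableau_distinct[OF T k k] by simp
  have tp: "?t permutes {1..2 * n}"
    using tableau_entry_range[OF T k] by (intro permutes_swap_id) auto
  have \<sigma>p: "\<sigma> permutes {1..2 * n}"
    and \<sigma>c: "\<And>j. j < n \<Longrightarrow> \<sigma> ` {fst T ! j, snd T ! j} = {fst T ! j, snd T ! j}"
    using \<sigma> by (auto simp: column_stabilizer_def)
  have tc: "?t ` {fst T ! j, snd T ! j} = {fst T ! j, snd T ! j}" if "j < n" for j
    using tableau_distinct[OF T that k] tableau_distinct[OF T k that]
    by (cases "j = k") (auto simp: Transposition.transpose_def)
  have "(?t \<circ> \<sigma>) ` {fst T ! j, snd T ! j} = {fst T ! j, snd T ! j}" if "j < n" for j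
    using tc[OF that] \<sigma>c[OF that] by (metis image_comp)
  then have "?t \<circ> \<sigma> \<in> column_stabilizer n T"
    using permutes_compose[OF \<sigma>p tp] by (simp add: column_stabilizer_def)
  moreover have "(?t \<circ> \<sigma>) (fst T ! j) = snd T ! j \<longleftrightarrow> j \<in> insert k J" if "j < n" for j
  proof (cases "j = k")
    case True
    \<comment> \<open>As \<open>k\<close> is not in \<open>J\<close>, the permutation built so far
      leaves column \<open>k\<close> alone.\<close>
    have "\<sigma> ?u \<noteq> ?v"
      using J insert.hyps k by blast
    then have "\<sigma> ?u = ?u"
      using \<sigma>c[OF k] by auto
    then show ?thesis
      using True by simp
  next
    case False
    have "\<sigma> (fst T ! j) \<in> {fst T ! j, snd T ! j}"
      using \<sigma>c[OF that] by blast
    then have "?t (\<sigma> (fst T ! j)) = \<sigma> (fst T ! j)"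
      using tableau_distinct[OF T that k] tableau_distinct[OF T k that] False
      by (auto simp: Transposition.transpose_def)
    then show ?thesis
      using False J that by auto
  qed
  moreover have "sign (?t \<circ> \<sigma>) = (- 1) ^ card (insert k J)"
  proof -
    have "sign (?t \<circ> \<sigma>) = sign ?t * sign \<sigma>"
      using tp \<sigma>p by (intro sign_compose) (auto simp: permutation_permutes)
    then show ?thesis
      using sgn ne insert.hyps by (simp add: sign_swap_id)
  qed
  ultimately show ?case
    using insert.prems by (intro bexI[of _ "?t \<circ> \<sigma>"]) (auto simp del: comp_apply)
qed

section \<open>Polytabloids as products over the columns\<close>

definition tabloids :: "nat \<Rightarrow> tabloid set" where
  "tabloids n = tabloid n ` tableaux n"

text \<open>All members of a tabloid share this row; the union recovers it without choosing a
  representative.\<close>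

definition first_row :: "tabloid \<Rightarrow> nat set" where
  "first_row X = (\<Union>R\<in>X. set (fst R))"

definition row_ind :: "tabloid \<Rightarrow> nat \<Rightarrow> complex" where
  "row_ind X x = of_bool (x \<in> first_row X)"

lemma first_row_tabloid:
  assumes "R \<in> tableaux n"
  shows "first_row (tabloid n R) = set (fst R)"
proof -
  have "R \<in> tabloid n R"
    using assms by (simp add: tabloid_def)
  moreover have "set (fst Q) = set (fst R)" if "Q \<in> tabloid n R" for Q
    using that by (simp add: tabloid_def)
  ultimately show ?thesis
    unfolding first_row_def by blast
qed

lemma tabloid_eq_iff:
  assumes "R \<in> tableaux n" "T \<in> tableaux n"
  shows "tabloid n R = tabloid n T \<longleftrightarrow> set (fst R) = set (fst T)"
proof
  assume "tabloid n R = tabloid n T"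
  then show "set (fst R) = set (fst T)"
    using assms first_row_tabloid by metis
next
  assume "set (fst R) = set (fst T)"
  moreover from this have "set (snd R) = set (snd T)"
    using tableau_rows(3) assms by metis
  ultimately show "tabloid n R = tabloid n T"
    by (simp add: tabloid_def)
qed

lemma sum_fun_apply: "sum f A x = (\<Sum>a\<in>A. f a x)"
  by (induction A rule: infinite_finite_induct) auto

text \<open>Expanding the product picks from each column either the top factor or minus the bottom
  one. The set \<open>J\<close> of bottom choices corresponds to the stabilizer element exchanging
  the columns in \<open>J\<close>, with sign (-1)^|J|, and the term is nonzero exactly when all
  chosen entries lie in the first row of \<open>X\<close>.\<close>

lemma polytabloid_eq:
  assumes T: "T \<in> tableaux n"
  shows "polytabloid n T X =
    (if X \<in> tabloids n then \<Prod>j<n. row_ind X (fst T ! j) - row_ind X (snd T ! j) else 0)"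
proof -
  let ?S = "column_stabilizer n T"
  let ?J = "\<lambda>\<sigma>. {j \<in> {..<n}. \<sigma> (fst T ! j) = snd T ! j}"
  have sum: "polytabloid n T X =
      (\<Sum>\<sigma>\<in>?S. of_int (sign \<sigma>) * of_bool (X = tabloid n (tab_act \<sigma> T)))"
    by (simp add: polytabloid_def sum_fun_apply cscale_def delta_def of_bool_def if_distrib cong: if_cong)
  have perm: "\<sigma> permutes {1..2 * n}" if "\<sigma> \<in> ?S" for \<sigma>
    using that by (simp add: column_stabilizer_def)
  show ?thesis
  proof (cases "X \<in> tabloids n")
    case False
    then have "X \<noteq> tabloid n (tab_act \<sigma> T)" if "\<sigma> \<in> ?S" for \<sigma>
      using tab_act_tableaux[OF T perm[OF that]] by (auto simp: tabloids_def)
    then show ?thesis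
      using False by (simp add: sum)
  next
    case True
    then obtain R where R: "R \<in> tableaux n" and X: "X = tabloid n R"
      by (auto simp: tabloids_def)
    let ?A = "set (fst R)"
    have ind: "row_ind X x = of_bool (x \<in> ?A)" for x
      by (simp add: row_ind_def X first_row_tabloid[OF R])
    let ?f = "\<lambda>j. - row_ind X (snd T ! j)" and ?g = "\<lambda>j. row_ind X (fst T ! j)"
    have bij: "bij_betw ?J ?S (Pow {..<n})"
      unfolding bij_betw_def
    proof
      show "inj_on ?J ?S"
        using column_stabilizer_ext[OF T] by (auto intro!: inj_onI)
      have "J \<in> ?J ` ?S" if "J \<subseteq> {..<n}" for J
        using column_stabilizer_exists[OF T finite_subset[OF that] that] by blast
      then show "?J ` ?S = Pow {..<n}"
        by blast
    qed
    have summand: "of_int (sign \<sigma>) * of_bool (X = tabloid n (tab_act \<sigma> T)) =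
        prod ?f (?J \<sigma>) * prod ?g ({..<n} - ?J \<sigma>)" if \<sigma>: "\<sigma> \<in> ?S" for \<sigma>
    proof -
      obtain \<tau> where "\<tau> \<in> ?S" "?J \<tau> = ?J \<sigma>" "sign \<tau> = (- 1) ^ card (?J \<sigma>)"
        using column_stabilizer_exists[OF T, of "?J \<sigma>"] by auto
      then have sgn: "sign \<sigma> = (- 1) ^ card (?J \<sigma>)"
        using column_stabilizer_ext[OF T \<sigma>, of \<tau>] by auto
      have val: "\<sigma> (fst T ! j) = (if j \<in> ?J \<sigma> then snd T ! j else fst T ! j)" if "j < n" for j
      proof -
        have "\<sigma> ` {fst T ! j, snd T ! j} = {fst T ! j, snd T ! j}"
          using \<sigma> that by (auto simp: column_stabilizer_def)
        then show ?thesis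
          using that by auto
      qed
      have T': "tab_act \<sigma> T \<in> tableaux n"
        using tab_act_tableaux[OF T perm[OF \<sigma>]] .
      have "X = tabloid n (tab_act \<sigma> T) \<longleftrightarrow> set (fst (tab_act \<sigma> T)) = ?A"
        using tabloid_eq_iff[OF R T'] by (auto simp: X)
      \<comment> \<open>Inclusion suffices because both rows have \<open>n\<close> elements.\<close>
      also have "\<dots> \<longleftrightarrow> set (fst (tab_act \<sigma> T)) \<subseteq> ?A"
        using tableau_rows(5)[OF R] tableau_rows(5)[OF T'] card_subset_eq[of ?A] by auto
      also have "\<dots> \<longleftrightarrow> (\<forall>j<n. \<sigma> (fst T ! j) \<in> ?A)"
        by (auto simp: set_tab_act tableau_rows(1)[OF T])
      also have "\<dots> \<longleftrightarrow> (\<forall>j\<in>?J \<sigma>. snd T ! j \<in> ?A) \<and> (\<forall>j\<in>{..<n} - ?J \<sigma>. fst T ! j \<in> ?A)"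
        by (subst all_cong[OF arg_cong[of _ _ "\<lambda>x. x \<in> ?A"], OF val]) auto
      finally have iff: "X = tabloid n (tab_act \<sigma> T) \<longleftrightarrow>
        (\<forall>j\<in>?J \<sigma>. snd T ! j \<in> ?A) \<and> (\<forall>j\<in>{..<n} - ?J \<sigma>. fst T ! j \<in> ?A)" .
      have b: "(\<Prod>j\<in>K. of_bool (P j) :: complex) = of_bool (\<forall>j\<in>K. P j)" if "finite K" for K P
        using that by (induction K rule: finite_induct) auto
      have "prod ?f (?J \<sigma>) = (- 1) ^ card (?J \<sigma>) * (\<Prod>j\<in>?J \<sigma>. row_ind X (snd T ! j))"
        by (subst prod_uminus) simp
      then show ?thesis
        by (simp add: ind b iff sgn)
    qed
    have "polytabloid n T X = (\<Sum>\<sigma>\<in>?S. prod ?f (?J \<sigma>) * prod ?g ({..<n} - ?J \<sigma>))"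
      unfolding sum by (rule sum.cong) (use summand in auto)
    also have "\<dots> = (\<Sum>J\<in>Pow {..<n}. prod ?f J * prod ?g ({..<n} - J))"
      using sum.reindex_bij_betw[OF bij] by fast
    \<comment> \<open>Distributivity, read backwards: subsets of columns are the choices made when
      the product is expanded.\<close>
    also have "\<dots> = (\<Prod>j<n. ?f j + ?g j)"
      by (rule prod_add[symmetric]) simp
    finally show ?thesis
      using True by simp
  qed
qed

section \<open>The action on tabloids and polytabloids\<close>

lemma tab_act_comp: "tab_act \<sigma> (tab_act \<tau> T) = tab_act (\<sigma> \<circ> \<tau>) T"
  by (cases T) (simp add: tab_act_def)

lemma tab_act_id: "tab_act id T = T"
  by (cases T) (simp add: tab_act_def)

lemma tab_act_image_tabloid:
  assumes R: "R \<in> tableaux n" and \<sigma>: "\<sigma> permutes {1..2 * n}"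
  shows "tab_act \<sigma> ` tabloid n R = tabloid n (tab_act \<sigma> R)"
proof
  \<comment> \<open>Stated for every permutation, because the converse inclusion uses it for the
    inverse.\<close>
  have sub: "tab_act \<tau> ` tabloid n Q \<subseteq> tabloid n (tab_act \<tau> Q)" if "\<tau> permutes {1..2 * n}" for \<tau> Q
    using tab_act_tableaux[OF _ that] by (auto simp: tabloid_def set_tab_act)
  show "tab_act \<sigma> ` tabloid n R \<subseteq> tabloid n (tab_act \<sigma> R)"
    using sub[OF \<sigma>] .
  show "tabloid n (tab_act \<sigma> R) \<subseteq> tab_act \<sigma> ` tabloid n R"
  proof
    fix Q assume "Q \<in> tabloid n (tab_act \<sigma> R)"
    then have "tab_act (inv \<sigma>) Q \<in> tabloid n R"
      using sub[OF permutes_inv[OF \<sigma>], of "tab_act \<sigma> R"]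
      by (auto simp: tab_act_comp permutes_inv_o[OF \<sigma>] tab_act_id)
    moreover have "Q = tab_act \<sigma> (tab_act (inv \<sigma>) Q)"
      by (simp add: tab_act_comp permutes_inv_o[OF \<sigma>] tab_act_id)
    ultimately show "Q \<in> tab_act \<sigma> ` tabloid n R"
      by blast
  qed
qed

lemma tab_act_image_tabloids:
  assumes "\<sigma> permutes {1..2 * n}"
  shows "tab_act \<sigma> ` X \<in> tabloids n \<longleftrightarrow> X \<in> tabloids n"
proof -
  have sub: "tab_act \<tau> ` Y \<in> tabloids n" if "\<tau> permutes {1..2 * n}" "Y \<in> tabloids n" for \<tau> Y
    using that tab_act_image_tabloid tab_act_tableaux unfolding tabloids_def by blast
  have "tab_act (inv \<sigma>) ` tab_act \<sigma> ` X = X"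
    by (simp add: image_image tab_act_comp permutes_inv_o[OF assms] tab_act_id)
  then show ?thesis
    using sub[OF assms, of X] sub[OF permutes_inv[OF assms], of "tab_act \<sigma> ` X"] by auto
qed

text \<open>Turns \<open>specht_act\<close> into the renaming of the variables x_a to x_{\<sigma> a}
  in the products.\<close>

lemma row_ind_tab_act_inv:
  assumes "\<sigma> permutes {1..2 * n}"
  shows "row_ind (tab_act (inv \<sigma>) ` X) x = row_ind X (\<sigma> x)"
proof -
  have "first_row (tab_act (inv \<sigma>) ` X) = inv \<sigma> ` first_row X"
    by (auto simp: first_row_def set_tab_act)
  moreover have "x \<in> inv \<sigma> ` A \<longleftrightarrow> \<sigma> x \<in> A" for A
    using permutes_inverses[OF assms] by (metis image_iff)
  ultimately show ?thesis
    by (simp add: row_ind_def)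
qed

lemma specht_act_polytabloid:
  assumes T: "T \<in> tableaux n" and \<sigma>: "\<sigma> permutes {1..2 * n}"
  shows "specht_act \<sigma> (polytabloid n T) = polytabloid n (tab_act \<sigma> T)"
proof
  fix X
  show "specht_act \<sigma> (polytabloid n T) X = polytabloid n (tab_act \<sigma> T) X"
    by (simp add: specht_act_def polytabloid_eq[OF T] polytabloid_eq[OF tab_act_tableaux[OF T \<sigma>]]
      tab_act_image_tabloids[OF permutes_inv[OF \<sigma>]] row_ind_tab_act_inv[OF \<sigma>] tab_act_nth[OF T])
qed

section \<open>Products over the arcs of a matching and their Plucker relations\<close>

definition matching_poly :: "nat \<Rightarrow> web \<Rightarrow> tabloid \<Rightarrow> complex" where
  "matching_poly n m X =
     (if X \<in> tabloids n then \<Prod>e\<in>m. row_ind X (Min e) - row_ind X (Max e) else 0)"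

definition columns :: "nat \<Rightarrow> tableau \<Rightarrow> web" where
  "columns n T = (\<lambda>j. {fst T ! j, snd T ! j}) ` {..<n}"

text \<open>The rows are left unordered, so that every matching arises as a set of columns.\<close>

definition column_increasing :: "nat \<Rightarrow> tableau \<Rightarrow> bool" where
  "column_increasing n T \<longleftrightarrow> T \<in> tableaux n \<and> (\<forall>j<n. fst T ! j < snd T ! j)"

lemma columns_matching:
  assumes "T \<in> tableaux n"
  shows "columns n T \<in> matchings n"
proof -
  have "\<Union>(columns n T) = {1..2 * n}"
    using tableau_rows(1,2,4)[OF assms] by (auto simp: columns_def)
  moreover have "disjnt p q" if "p \<in> columns n T" "q \<in> columns n T" "p \<noteq> q" for p q
    using that tableau_distinct[OF assms] by (auto simp: columns_def disjnt_def)
  moreover have "card e = 2" if "e \<in> columns n T" for e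
    using that tableau_distinct[OF assms] by (auto simp: columns_def)
  moreover have "{} \<notin> columns n T"
    by (auto simp: columns_def)
  ultimately show ?thesis
    unfolding matchings_def by (intro CollectI conjI ballI partition_onI)
qed

lemma left_endpoints_columns:
  assumes "column_increasing n T"
  shows "left_endpoints (columns n T) = set (fst T)"
proof -
  have T: "T \<in> tableaux n" and lt: "\<And>j. j < n \<Longrightarrow> fst T ! j < snd T ! j"
    using assms by (auto simp: column_increasing_def)
  have "left_endpoints (columns n T) = (\<lambda>j. Min {fst T ! j, snd T ! j}) ` {..<n}"
    unfolding left_endpoints_eq_Min[OF columns_matching[OF T]] unfolding columns_def image_image ..
  also have "\<dots> = (\<lambda>j. fst T ! j) ` {..<n}"
    using lt by (intro image_cong) (auto simp: less_imp_le min_absorb1)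
  finally show ?thesis
    by (simp add: tableau_rows(1)[OF T])
qed

text \<open>The top entry is the left end point of its column, so both products orient their factors
  alike and no sign appears.\<close>

lemma polytabloid_columns:
  assumes "column_increasing n T"
  shows "polytabloid n T = matching_poly n (columns n T)"
proof
  fix X
  have T: "T \<in> tableaux n" and lt: "\<And>j. j < n \<Longrightarrow> fst T ! j < snd T ! j"
    using assms by (auto simp: column_increasing_def)
  have "inj_on (\<lambda>j. {fst T ! j, snd T ! j}) {..<n}"
    using tableau_distinct[OF T] by (auto intro!: inj_onI simp: doubleton_eq_iff)
  then show "polytabloid n T X = matching_poly n (columns n T) X"
    using lt by (auto simp: polytabloid_eq[OF T] matching_poly_def columns_def prod.reindex
      less_imp_le min_absorb1 max_absorb2 intro!: prod.cong)
qed

text \<open>List the arcs in any order and put the smaller end point on top.\<close>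

lemma matching_tableau:
  assumes m: "m \<in> matchings n"
  obtains T where "column_increasing n T" "columns n T = m"
proof -
  obtain es where es: "set es = m" "distinct es"
    using finite_distinct_list[OF finite_matching[OF m]] by blast
  then have len: "length es = n"
    using card_matching[OF m] distinct_card by fastforce
  define T where "T = (map Min es, map Max es)"
  have "set (fst T) = left_endpoints m"
    by (simp add: T_def es(1) left_endpoints_eq_Min[OF m])
  moreover have "set (snd T) = {1..2 * n} - left_endpoints m"
    using Max_image_matching[OF m] by (simp add: T_def es(1))
  ultimately have "T \<in> tableaux n"
    using len es inj_on_Min[OF m] inj_on_Max[OF m] left_endpoints_subset[OF m]
    by (auto simp: tableaux_def T_def distinct_map)
  moreover have col: "fst T ! j < snd T ! j" "{fst T ! j, snd T ! j} = es ! j" if j: "j < n" for j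
  proof -
    have "es ! j \<in> m"
      using es(1) len j by auto
    then obtain a b where "es ! j = {a, b}" "a < b"
      using arc_obtain[OF m] by metis
    then show "fst T ! j < snd T ! j" "{fst T ! j, snd T ! j} = es ! j"
      using j len by (auto simp: T_def)
  qed
  moreover have "columns n T = m"
    using col(2) len es(1) by (auto simp: columns_def set_conv_nth image_iff Bex_def)
  ultimately show ?thesis
    using that[of T] by (simp add: column_increasing_def)
qed

text \<open>Needed because \<open>\<rho>\<close> is additive and equivariant only on
  \<open>specht n\<close>.\<close>

lemma matching_poly_specht:
  assumes "m \<in> matchings n"
  shows "matching_poly n m \<in> specht n"
  using matching_tableau[OF assms] polytabloid_columns
  unfolding specht_def column_increasing_def by (metis cfun.span_base image_eqI)

lemma Min_Max_arc:
  assumes "a < (b :: nat)"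
  shows "Min {a, b} = a" "Max {a, b} = b"
  using assms by auto

lemma matching_poly_crossing:
  assumes m: "m \<in> matchings n" and ab: "a < b" "b < c" "c < d"
    and arcs: "{a, c} \<in> m" "{b, d} \<in> m"
  shows "matching_poly n m =
    matching_poly n ((m - {{a, c}, {b, d}}) \<union> {{a, b}, {c, d}}) +
    matching_poly n ((m - {{a, c}, {b, d}}) \<union> {{a, d}, {b, c}})"
proof
  fix X
  have ne: "{a, c} \<noteq> {b, d}"
    using ab by (auto simp: doubleton_eq_iff)
  have r: "{a, b} \<union> {c, d} = {a, c} \<union> {b, d}" "{a, b} \<inter> {c, d} = {}"
      "card {a, b} = 2" "card {c, d} = 2"
    "{a, d} \<union> {b, c} = {a, c} \<union> {b, d}" "{a, d} \<inter> {b, c} = {}"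
      "card {a, d} = 2" "card {b, c} = 2"
    using ab by auto
  note c = matching_rewire(2-4)[OF m arcs r(1-4)] matching_rewire(2-4)[OF m arcs r(5-8)]
  \<comment> \<open>After the common factor of the untouched arcs is split off, the Plucker relation
    in four variables remains.\<close>
  show "matching_poly n m X =
    (matching_poly n ((m - {{a, c}, {b, d}}) \<union> {{a, b}, {c, d}}) +
    matching_poly n ((m - {{a, c}, {b, d}}) \<union> {{a, d}, {b, c}})) X"
    unfolding matching_poly_def plus_fun_def
      prod.rewire(1)[OF finite_matching[OF m] arcs ne c(1-3)]
      prod.rewire(2)[OF finite_matching[OF m] arcs ne c(1-3)]
      prod.rewire(2)[OF finite_matching[OF m] arcs ne c(4-6)]
    using ab by (simp add: Min_Max_arc algebra_simps)
qed

text \<open>The transposition turns the two arcs into the crossing pair \<open>{p, i + 1}\<close>, \<open>{i, q}\<close>, so this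
  is again the Plucker relation.\<close>

lemma specht_act_matching_poly:
  assumes m: "m \<in> matchings n" and i: "p < i" "i + 1 < q"
    and arcs: "{p, i} \<in> m" "{i + 1, q} \<in> m"
  shows "specht_act (simple_transp i) (matching_poly n m) =
    matching_poly n m + matching_poly n (web_switch i m)"
proof
  fix X
  let ?s = "simple_transp i"
  have i2: "i \<in> {1..2 * n}" "i + 1 \<in> {1..2 * n}"
    using arc_range[OF m arcs(1)] arc_range[OF m arcs(2)] by auto
  have s: "?s permutes {1..2 * n}"
    using i2 by (intro permutes_swap_id) auto
  have ne: "{p, i} \<noteq> {i + 1, q}"
    using i by (auto simp: doubleton_eq_iff)
  have "{i, i + 1} \<union> {p, q} = {p, i} \<union> {i + 1, q}" "{i, i + 1} \<inter> {p, q} = {}"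
    "card {i, i + 1} = 2" "card {p, q} = 2"
    using i by auto
  note c = matching_rewire(2-4)[OF m arcs this]
  have sw: "web_switch i m = (m - {{p, i}, {i + 1, q}}) \<union> {{i, i + 1}, {p, q}}"
    using partner_eq[OF m, of i p] partner_eq[OF m, of "i + 1" q] arcs
    by (simp add: web_switch_def insert_commute)
  have fixed: "?s x = x" if "x \<in> e" "e \<in> m - {{p, i}, {i + 1, q}}" for x e
  proof -
    have "x \<noteq> i" "x \<noteq> i + 1"
      using that arc_disjoint[OF m, of e "{p, i}" i] arc_disjoint[OF m, of e "{i + 1, q}" "i + 1"] arcs
      by auto
    then show ?thesis
      by simp
  qed
  have rest: "(\<Prod>e\<in>m - {{p, i}, {i + 1, q}}. row_ind X (?s (Min e)) - row_ind X (?s (Max e))) =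
    (\<Prod>e\<in>m - {{p, i}, {i + 1, q}}. row_ind X (Min e) - row_ind X (Max e))"
  proof (rule prod.cong[OF refl])
    fix e assume e: "e \<in> m - {{p, i}, {i + 1, q}}"
    then show "row_ind X (?s (Min e)) - row_ind X (?s (Max e)) = row_ind X (Min e) - row_ind X (Max e)"
      using fixed[OF Min_arc[OF m] e] fixed[OF Max_arc[OF m] e] by simp
  qed
  have sv: "?s p = p" "?s q = q" "?s i = i + 1" "?s (i + 1) = i"
    using i by auto
  have act: "specht_act ?s (matching_poly n m) X =
      (if X \<in> tabloids n then \<Prod>e\<in>m. row_ind X (?s (Min e)) - row_ind X (?s (Max e)) else 0)"
    unfolding specht_act_def matching_poly_def tab_act_image_tabloids[OF permutes_inv[OF s]]
      row_ind_tab_act_inv[OF s] ..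
  have "row_ind X (?s p) = row_ind X p" "row_ind X (?s q) = row_ind X q"
    using i by auto
  then show "specht_act ?s (matching_poly n m) X =
      (matching_poly n m + matching_poly n (web_switch i m)) X"
    unfolding act sw matching_poly_def plus_fun_def
      prod.rewire(1)[OF finite_matching[OF m] arcs ne c]
      prod.rewire(2)[OF finite_matching[OF m] arcs ne c] rest
    using i by (simp add: Min_Max_arc algebra_simps)
qed

section \<open>Lattice paths and the tableau graph\<close>

lemma standard_column_increasing: "T \<in> standard_tableaux n \<Longrightarrow> column_increasing n T"
  by (auto simp: standard_tableaux_def column_increasing_def)

text \<open>The second row is the complement of the first, and sortedness fixes the order; so a
  tableau may be replaced by its lattice path.\<close>

lemma standard_tableau_eqI:
  assumes S: "S \<in> standard_tableaux n" and T: "T \<in> standard_tableaux n"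
    and eq: "set (fst S) = set (fst T)"
  shows "S = T"
proof -
  have "set (snd S) = set (snd T)"
    using S T eq tableau_rows(3)[of S n] tableau_rows(3)[of T n] by (auto simp: standard_tableaux_def)
  then show ?thesis
    using S T eq by (auto simp: standard_tableaux_def intro!: prod_eqI intro: strict_sorted_equal)
qed

lemma finite_standard_tableaux: "finite (standard_tableaux n)"
proof (rule finite_imageD)
  have "(\<lambda>T. set (fst T)) ` standard_tableaux n \<subseteq> Pow {1..2 * n}"
    by (auto simp: standard_tableaux_def tableaux_def)
  then show "finite ((\<lambda>T. set (fst T)) ` standard_tableaux n)"
    by (rule finite_subset) simp
  show "inj_on (\<lambda>T. set (fst T)) (standard_tableaux n)"
    by (rule inj_onI) (rule standard_tableau_eqI)
qed

text \<open>A valley of the lattice path becomes a peak. No row contains both \<open>i\<close> and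
  \<open>i + 1\<close>, and no column has \<open>i + 1\<close> above \<open>i\<close>, so all
  inequalities survive the exchange.\<close>

lemma standard_tableau_swap:
  assumes T: "T \<in> standard_tableaux n" and i: "i \<in> set (snd T)" "i + 1 \<in> set (fst T)"
  shows "(T, tab_act (simple_transp i) T) \<in> tableau_graph n"
    and "set (fst (tab_act (simple_transp i) T)) = insert i (set (fst T) - {i + 1})"
proof -
  let ?s = "simple_transp i"
  have T': "T \<in> tableaux n" and st: "sorted_wrt (<) (fst T)" "sorted_wrt (<) (snd T)"
    and col: "\<And>j. j < n \<Longrightarrow> fst T ! j < snd T ! j"
    using T by (auto simp: standard_tableaux_def)
  have rng: "i \<in> {1..2 * n}" "i + 1 \<in> {1..2 * n}"
    using i tableau_rows(4)[OF T'] by blast+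
  have i1: "i \<notin> set (fst T)" "i + 1 \<notin> set (snd T)"
    using i tableau_rows(3)[OF T'] by blast+
  have s: "?s permutes {1..2 * n}"
    using rng by (intro permutes_swap_id) auto
  have up: "?s x = (if x = i + 1 then i else x)" if "x \<in> set (fst T)" for x
    using that i1 by (auto simp: Transposition.transpose_def)
  have down: "?s x = (if x = i then i + 1 else x)" if "x \<in> set (snd T)" for x
    using that i1 by (auto simp: Transposition.transpose_def)
  have "sorted_wrt (<) (map ?s (fst T))"
    unfolding sorted_wrt_map
  proof (rule sorted_wrt_mono_rel[OF _ st(1)])
    fix x y assume "x \<in> set (fst T)" "y \<in> set (fst T)" "x < y"
    moreover have "x \<noteq> i" "y \<noteq> i" using calculation i1 by auto
    ultimately show "?s x < ?s y" by (simp only: up) auto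
  qed
  moreover have "sorted_wrt (<) (map ?s (snd T))"
    unfolding sorted_wrt_map
  proof (rule sorted_wrt_mono_rel[OF _ st(2)])
    fix x y assume "x \<in> set (snd T)" "y \<in> set (snd T)" "x < y"
    moreover have "x \<noteq> i + 1" "y \<noteq> i + 1" using calculation i1 by auto
    ultimately show "?s x < ?s y" by (simp only: down) auto
  qed
  moreover have "?s (fst T ! j) < ?s (snd T ! j)" if j: "j < n" for j
  proof -
    have "fst T ! j \<in> set (fst T)" "snd T ! j \<in> set (snd T)"
      using T' j by (auto simp: tableaux_def)
    then show ?thesis
      using col[OF j] by (simp only: up down) auto
  qed
  ultimately have "tab_act ?s T \<in> standard_tableaux n"
    using tab_act_tableaux[OF T' s] by (simp add: standard_tableaux_def tab_act_nth[OF T'])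
      (simp add: tab_act_def)
  then show "(T, tab_act ?s T) \<in> tableau_graph n"
    using T i rng by (auto simp: tableau_graph_def)
  have "?s ` set (fst T) = (\<lambda>x. if x = i + 1 then i else x) ` set (fst T)"
    using up by (intro image_cong) auto
  also have "\<dots> = insert i (set (fst T) - {i + 1})"
    using i by auto
  finally show "set (fst (tab_act ?s T)) = insert i (set (fst T) - {i + 1})"
    by (simp add: set_tab_act)
qed

text \<open>For a set \<open>F\<close> of positive numbers, the lattice path with up steps at
  \<open>F\<close> has ordinate \<open>2 * height F k - k\<close> after \<open>k\<close> steps, so
  comparing heights compares paths pointwise.\<close>

definition height :: "nat set \<Rightarrow> nat \<Rightarrow> nat" where
  "height F k = card (F \<inter> {..k})"

lemma height_Suc: "height F (Suc k) = height F k + of_bool (Suc k \<in> F)"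
proof -
  have "F \<inter> {..Suc k} = (if Suc k \<in> F then insert (Suc k) (F \<inter> {..k}) else F \<inter> {..k})"
    by (auto simp: le_Suc_eq)
  then show ?thesis
    by (simp add: height_def)
qed

text \<open>Only the prefix \<open>{..i}\<close> contains \<open>i\<close> but not
  \<open>i + 1\<close>.\<close>

lemma height_swap:
  assumes "i \<notin> F" "i + 1 \<in> F"
  shows "height (insert i (F - {i + 1})) k = height F k + of_bool (k = i)"
proof -
  consider "k < i" | "k = i" | "i < k" by linarith
  then show ?thesis
  proof cases
    case 1
    then have "insert i (F - {i + 1}) \<inter> {..k} = F \<inter> {..k}"
      by auto
    then show ?thesis using 1 by (simp add: height_def)
  next
    case 2
    then have "insert i (F - {i + 1}) \<inter> {..k} = insert i (F \<inter> {..k})"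
      by auto
    then show ?thesis using 2 assms by (simp add: height_def)
  next
    case 3
    then have "insert i (F - {i + 1}) \<inter> {..k} = insert i (F \<inter> {..k} - {i + 1})"
      by auto
    moreover have "card (insert i (F \<inter> {..k} - {i + 1})) = Suc (card (F \<inter> {..k} - {i + 1}))"
      using assms by simp
    moreover have "Suc (card (F \<inter> {..k} - {i + 1})) = card (F \<inter> {..k})"
      using assms 3 by (intro card_Suc_Diff1) auto
    ultimately show ?thesis using 3 by (simp add: height_def)
  qed
qed

text \<open>Postponing an up step lowers the path: sending \<open>b\<close> to \<open>c\<close> maps
  the up steps of \<open>F\<close> up to \<open>k\<close> onto a set containing those of
  \<open>G\<close>, since \<open>c \<le> k\<close> forces \<open>b \<le> k\<close>.\<close>

lemma height_replace_le:
  assumes "b \<in> F" "b < c" "G \<subseteq> insert c (F - {b})"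
  shows "height G k \<le> height F k"
proof -
  let ?g = "\<lambda>x. if x = b then c else x"
  have "G \<inter> {..k} \<subseteq> ?g ` (F \<inter> {..k})"
  proof
    fix x assume "x \<in> G \<inter> {..k}"
    then consider "x = c" "c \<le> k" | "x \<in> F" "x \<noteq> b" "x \<le> k"
      using assms by auto
    then show "x \<in> ?g ` (F \<inter> {..k})"
    proof cases
      case 1
      then show ?thesis using assms by (intro image_eqI[of _ _ b]) auto
    next
      case 2
      then show ?thesis by (intro image_eqI[of _ _ x]) auto
    qed
  qed
  then have "card (G \<inter> {..k}) \<le> card (?g ` (F \<inter> {..k}))"
    by (intro card_mono) auto
  also have "\<dots> \<le> card (F \<inter> {..k})"
    by (intro card_image_le) auto
  finally show ?thesis
    by (simp add: height_def)
qed

lemma height_eqD: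
  assumes "0 \<notin> F" "0 \<notin> G" "\<And>k. height F k = height G k"
  shows "F = G"
proof (rule set_eqI)
  fix x
  show "x \<in> F \<longleftrightarrow> x \<in> G"
  proof (cases x)
    case 0
    then show ?thesis using assms by simp
  next
    case (Suc k)
    then show ?thesis
      using assms(3)[of k] assms(3)[of "Suc k"] by (auto simp: height_Suc of_bool_def split: if_splits)
  qed
qed

text \<open>The up steps of Dyck paths of length \<open>2 * n\<close>: the cardinality makes the
  path return to the axis, and the last clause keeps it from going below.\<close>

definition ballot :: "nat \<Rightarrow> nat set \<Rightarrow> bool" where
  "ballot n F \<longleftrightarrow> F \<subseteq> {1..2 * n} \<and> card F = n \<and> (\<forall>k\<le>2 * n. k \<le> 2 * height F k)"

lemma height_0: "F \<subseteq> {1..m} \<Longrightarrow> height F 0 = 0"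
  by (auto simp: height_def)

lemma height_ge:
  assumes "F \<subseteq> {1..m}" "m \<le> k"
  shows "height F k = card F"
proof -
  have "F \<inter> {..k} = F"
    using assms by auto
  then show ?thesis
    by (simp add: height_def)
qed

text \<open>Each right end point up to \<open>k\<close> has its left end point there too, so at
  least half of the first \<open>k\<close> points are left end points.\<close>

lemma ballot_left_endpoints:
  assumes m: "m \<in> matchings n"
  shows "ballot n (left_endpoints m)"
proof -
  have "k \<le> 2 * height (left_endpoints m) k" if k: "k \<le> 2 * n" for k
  proof -
    let ?L = "left_endpoints m \<inter> {..k}" and ?E = "{e \<in> m. Max e \<le> k}"
    have fin: "finite ?E"
      using finite_matching[OF m] by simp
    have "{1..k} \<subseteq> ?L \<union> Max ` ?E"
    proof
      fix x assume x: "x \<in> {1..k}"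
      show "x \<in> ?L \<union> Max ` ?E"
      proof (cases "x \<in> left_endpoints m")
        case False
        then have "x \<in> Max ` m"
          using x k Max_image_matching[OF m] by auto
        then show ?thesis
          using x by auto
      qed (use x in auto)
    qed
    then have "card {1..k} \<le> card (?L \<union> Max ` ?E)"
      using fin by (intro card_mono) auto
    also have "\<dots> \<le> card ?L + card (Max ` ?E)"
      by (rule card_Un_le)
    also have "card (Max ` ?E) \<le> card ?E"
      by (rule card_image_le[OF fin])
    also have "card ?E = card (Min ` ?E)"
      using inj_on_Min[OF m] by (intro card_image[symmetric]) (auto intro: inj_on_subset)
    also have "\<dots> \<le> card ?L"
    proof (rule card_mono)
      show "Min ` ?E \<subseteq> ?L"
      proof
        fix x assume "x \<in> Min ` ?E"
        then obtain e where e: "e \<in> m" "Max e \<le> k" "x = Min e"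
          by blast
        moreover obtain a b where "e = {a, b}" "a < b"
          using arc_obtain[OF m e(1)] by blast
        ultimately show "x \<in> ?L"
          using mem_left_endpoints[OF m, of a b] by auto
      qed
    qed simp
    finally show ?thesis
      by (simp add: height_def)
  qed
  then show ?thesis
    using left_endpoints_subset[OF m] card_left_endpoints[OF m] by (simp add: ballot_def)
qed

lemma ballot_first_row:
  assumes "T \<in> standard_tableaux n"
  shows "ballot n (set (fst T))"
  using ballot_left_endpoints[OF columns_matching, of T n]
    left_endpoints_columns[OF standard_column_increasing[OF assms]] assms
  by (simp add: standard_tableaux_def)

text \<open>Induction on the area between the two paths. The tableau with first row \<open>F\<close>
  is part of the conclusion, so a ballot set alone can serve as the target.\<close>

lemma tableau_le_if_height_le:
  assumes S: "S \<in> standard_tableaux n" and F: "ballot n F"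
    and le: "\<And>k. height (set (fst S)) k \<le> height F k"
  shows "\<exists>T \<in> standard_tableaux n. set (fst T) = F \<and> tableau_le n S T"
  using S le
proof (induction "\<Sum>k\<le>2 * n. height F k - height (set (fst S)) k" arbitrary: S rule: less_induct)
  case (less S)
  let ?G = "set (fst S)"
  have G: "ballot n ?G"
    using ballot_first_row[OF less.prems(1)] .
  show ?case
  proof (cases "?G = F")
    case True
    then show ?thesis
      using less.prems(1) by (auto simp: tableau_le_def)
  next
    case False
    \<comment> \<open>The places where the paths differ; both ends are excluded because the paths
      meet there.\<close>
    let ?K = "{k. height ?G k < height F k}"
    have K0: "?K \<subseteq> {1..<2 * n}"
    proof
      fix k assume k: "k \<in> ?K"
      have "k \<noteq> 0"
        using k F height_0[of F "2 * n"] by (metis ballot_def less_nat_zero_code mem_Collect_eq)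
      moreover have "k < 2 * n"
      proof (rule ccontr)
        assume "\<not> k < 2 * n"
        then have "height F k = n" "height ?G k = n"
          using F G height_ge[of _ "2 * n" k] by (auto simp: ballot_def)
        then show False
          using k by simp
      qed
      ultimately show "k \<in> {1..<2 * n}"
        by simp
    qed
    have "0 \<notin> ?G" "0 \<notin> F"
      using F G unfolding ballot_def by auto
    then have "\<exists>k. height ?G k \<noteq> height F k"
      using False height_eqD[of ?G F] by blast
    then have "?K \<noteq> {}"
      using less.prems(2) by (auto simp: le_less)
    moreover have "finite ?K"
      using K0 by (rule finite_subset) simp
    \<comment> \<open>A place of smallest ordinate on the path of \<open>S\<close> among those in
      \<open>?K\<close>.\<close>
    ultimately obtain k where k: "k \<in> ?K"
      and min: "\<And>j. j \<in> ?K \<Longrightarrow> 2 * int (height ?G k) - int k \<le> 2 * int (height ?G j) - int j"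
      using ex_min_if_finite[of "(\<lambda>k. 2 * int (height ?G k) - int k) ` ?K"]
      by (metis (mono_tags, lifting) arg_min_if_finite(1) arg_min_least)
    have lt: "height ?G k < height F k" and rng: "1 \<le> k" "k < 2 * n"
      using k K0 by auto
    \<comment> \<open>An up step into \<open>k\<close>, or below a down step out of
      \<open>k\<close>, would give a neighbour that is lower on the path of \<open>S\<close> and
      still in \<open>?K\<close>. Hence \<open>k\<close> is a valley, where an edge of the graph
      applies.\<close>
    have "k \<notin> ?G"
    proof
      assume *: "k \<in> ?G"
      obtain j where j: "k = Suc j"
        using rng by (cases k) auto
      have h: "height ?G k = height ?G j + 1"
        using * j height_Suc[of ?G j] by simp
      have "height F k \<le> height F j + 1"
        using j height_Suc[of F j] by simp
      then have "j \<in> ?K"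
        using lt h by simp
      then show False
        using min[of j] h j by simp
    qed
    have "k + 1 \<in> ?G"
    proof (rule ccontr)
      assume *: "k + 1 \<notin> ?G"
      have h: "height ?G (Suc k) = height ?G k"
        using * height_Suc[of ?G k] by simp
      have "height F k \<le> height F (Suc k)"
        using height_Suc[of F k] by simp
      then have "Suc k \<in> ?K"
        using lt h by simp
      then show False
        using min[of "Suc k"] h by simp
    qed
    have kS: "k \<in> set (snd S)"
      using \<open>k \<notin> ?G\<close> rng less.prems(1) tableau_rows(3)[of S n] by (auto simp: standard_tableaux_def)
    define S' where "S' = tab_act (simple_transp k) S"
    have edge: "(S, S') \<in> tableau_graph n" and row: "set (fst S') = insert k (?G - {k + 1})"
      using standard_tableau_swap[OF less.prems(1) kS \<open>k + 1 \<in> ?G\<close>] by (simp_all add: S'_def)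
    have S': "S' \<in> standard_tableaux n"
      using edge by (auto simp: tableau_graph_def)
    have h: "height (set (fst S')) j = height ?G j + of_bool (j = k)" for j
      unfolding row by (rule height_swap[OF \<open>k \<notin> ?G\<close> \<open>k + 1 \<in> ?G\<close>])
    have le: "height (set (fst S')) j \<le> height F j" for j
      using less.prems(2)[of j] lt by (simp add: h)
    \<comment> \<open>Only the term at \<open>k\<close> changes; it was positive, so it really drops
      despite truncated subtraction.\<close>
    have "(\<Sum>j\<le>2 * n. height F j - height (set (fst S')) j) < (\<Sum>j\<le>2 * n. height F j - height ?G j)"
      using rng lt by (intro sum_strict_mono_ex1) (auto simp: h intro!: bexI[of _ k])
    then obtain T where "T \<in> standard_tableaux n" "set (fst T) = F" "tableau_le n S' T"
      using less.hyps[OF _ S' le] by blast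
    then show ?thesis
      using edge by (auto simp: tableau_le_def intro: converse_rtrancl_into_rtrancl)
  qed
qed

section \<open>The lowest path\<close>

lemma set_fst_T0: "set (fst (T0 n)) = {k. odd k \<and> k < 2 * n}"
  by (auto simp: T0_def image_iff elim!: oddE)

lemma set_snd_T0: "set (snd (T0 n)) = {k. even k \<and> 1 \<le> k \<and> k \<le> 2 * n}"
proof -
  have "k \<in> (\<lambda>j. 2 * j + 2) ` {..<n}" if k: "even k" "1 \<le> k" "k \<le> 2 * n" for k
  proof -
    obtain j where "k = 2 * j" using k(1) by (elim evenE)
    then show ?thesis
      using k by (intro image_eqI[of _ _ "j - 1"]) auto
  qed
  then have "{k. even k \<and> 1 \<le> k \<and> k \<le> 2 * n} \<subseteq> (\<lambda>j. 2 * j + 2) ` {..<n}"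
    by blast
  moreover have "(\<lambda>j. 2 * j + 2) ` {..<n} \<subseteq> {k. even k \<and> 1 \<le> k \<and> k \<le> 2 * n}"
    by auto
  moreover have "set (snd (T0 n)) = (\<lambda>j. 2 * j + 2) ` {..<n}"
    by (simp add: T0_def atLeast0LessThan)
  ultimately show ?thesis
    by (simp only: subset_antisym)
qed

lemma T0_standard: "T0 n \<in> standard_tableaux n"
proof -
  have "set (fst (T0 n)) \<inter> set (snd (T0 n)) = {}"
    unfolding set_fst_T0 set_snd_T0 by auto
  moreover have "set (fst (T0 n)) \<union> set (snd (T0 n)) = {1..2 * n}"
    unfolding set_fst_T0 set_snd_T0 by (auto simp: Suc_le_eq odd_pos) presburger+
  moreover have "length (fst (T0 n)) = n" "length (snd (T0 n)) = n"
    "distinct (fst (T0 n))" "distinct (snd (T0 n))"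
    by (auto simp: T0_def distinct_map inj_on_def)
  moreover have "sorted_wrt (<) (fst (T0 n))" "sorted_wrt (<) (snd (T0 n))"
    by (auto simp: T0_def sorted_wrt_map intro: sorted_wrt_mono_rel[OF _ sorted_wrt_upt])
  ultimately show ?thesis
    by (simp add: standard_tableaux_def tableaux_def) (simp add: T0_def)
qed

lemma height_T0: "2 * height (set (fst (T0 n))) k \<le> (if odd k then k + 1 else k)"
proof (induction k)
  case 0
  then show ?case by (simp add: height_def set_fst_T0)
next
  case (Suc k)
  then show ?case
    by (auto simp: height_Suc set_fst_T0 split: if_splits)
qed

text \<open>The path of \<open>T0\<close> alternates between ordinates 0 and 1. A ballot path has
  ordinate at least 0, and by parity at least 1 after an odd number of steps.\<close>

lemma height_T0_le:
  assumes "ballot n F"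
  shows "height (set (fst (T0 n))) k \<le> height F k"
proof (cases "k \<le> 2 * n")
  case True
  then have "k \<le> 2 * height F k"
    using assms by (simp add: ballot_def)
  then show ?thesis
    using height_T0[of n k] by (auto split: if_splits)
next
  case False
  then have "height F k = n" "height (set (fst (T0 n))) k = n"
    using assms ballot_first_row[OF T0_standard[of n]] height_ge[of _ "2 * n" k]
    by (auto simp: ballot_def)
  then show ?thesis
    by simp
qed

section \<open>Expansion into cup diagrams\<close>

text \<open>Left end points are minima of arcs, and \<open>Min\<close> is injective on a matching,
  so its image commutes with removing arcs.\<close>

lemma left_endpoints_rewire:
  assumes m: "m \<in> matchings n" and e: "e1 \<in> m" "e2 \<in> m" "e1 \<noteq> e2"
    and f: "e3 \<union> e4 = e1 \<union> e2" "e3 \<inter> e4 = {}" "card e3 = 2" "card e4 = 2"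
  shows "left_endpoints ((m - {e1, e2}) \<union> {e3, e4}) =
    (left_endpoints m - {Min e1, Min e2}) \<union> {Min e3, Min e4}"
proof -
  have "Min ` (m - {e1, e2}) = Min ` m - Min ` {e1, e2}"
    using inj_on_Min[OF m] e by (intro inj_on_image_set_diff[of _ m]) auto
  then show ?thesis
    using left_endpoints_eq_Min[OF m] left_endpoints_eq_Min[OF matching_rewire(1)[OF m e(1,2) f]]
    by (simp add: image_Un del: Un_insert_right)
qed

text \<open>Any strictly increasing and strictly concave function of the length of an arc decreases
  under both resolutions of a crossing; this is one on the arcs inside \<open>{1..2 * n}\<close>.\<close>

definition arc_weight :: "nat \<Rightarrow> nat set \<Rightarrow> nat" where
  "arc_weight n e = (Max e - Min e) * (4 * n - (Max e - Min e))"

lemma arc_weight_resolve: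
  assumes "a < b" "b < c" "c < d" "d \<le> 2 * n"
  shows "arc_weight n {a, b} + arc_weight n {c, d} < arc_weight n {a, c} + arc_weight n {b, d}"
    and "arc_weight n {a, d} + arc_weight n {b, c} < arc_weight n {a, c} + arc_weight n {b, d}"
proof -
  \<comment> \<open>The gaps between the four points, which turn differences into sums.\<close>
  obtain x y z where xyz: "b = a + x" "c = a + x + y" "d = a + x + y + z"
    using assms by (metis add.assoc less_imp_add_positive)
  have pos: "0 < x" "0 < y" "0 < z"
    using assms xyz by auto
  \<comment> \<open>The slack \<open>r\<close> exists because \<open>d \<le> 2 * n\<close>; it
    removes the remaining truncated subtractions.\<close>
  obtain r where r: "4 * n = r + 2 * (x + y + z)"
    using assms(4) xyz le_Suc_ex[of "2 * (x + y + z)" "4 * n"] by (auto simp: add.commute)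
  have sub: "4 * n - x = r + x + 2 * y + 2 * z" "4 * n - z = r + 2 * x + 2 * y + z"
    "4 * n - (x + y) = r + x + y + 2 * z" "4 * n - (y + z) = r + 2 * x + y + z"
    "4 * n - (x + y + z) = r + x + y + z" "4 * n - y = r + 2 * x + y + 2 * z"
    using r by auto
  have w: "arc_weight n {a, b} = x * (r + x + 2 * y + 2 * z)"
    "arc_weight n {c, d} = z * (r + 2 * x + 2 * y + z)"
    "arc_weight n {a, c} = (x + y) * (r + x + y + 2 * z)"
    "arc_weight n {b, d} = (y + z) * (r + 2 * x + y + z)"
    "arc_weight n {a, d} = (x + y + z) * (r + x + y + z)"
    "arc_weight n {b, c} = y * (r + 2 * x + y + 2 * z)"
    using pos by (simp_all add: arc_weight_def Min_Max_arc xyz sub add.assoc[symmetric])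
  \<comment> \<open>The two losses of weight are \<open>2 * y * (r + x + y + z)\<close> and
    \<open>2 * x * z\<close>.\<close>
  have "0 < x * z" "0 < y * y"
    using pos by auto
  then show "arc_weight n {a, b} + arc_weight n {c, d} < arc_weight n {a, c} + arc_weight n {b, d}"
    and "arc_weight n {a, d} + arc_weight n {b, c} < arc_weight n {a, c} + arc_weight n {b, d}"
    unfolding w by (simp_all add: algebra_simps)
qed

lemma web_switch_eq:
  assumes m: "m \<in> matchings n" and arcs: "{p, i} \<in> m" "{i + 1, q} \<in> m"
  shows "web_switch i m = (m - {{p, i}, {i + 1, q}}) \<union> {{i, i + 1}, {p, q}}"
  using partner_eq[OF m, of i p] partner_eq[OF m, of "i + 1" q] arcs
  by (simp add: web_switch_def insert_commute)

text \<open>The left end points change exactly as the first row does along an edge of the tableau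
  graph.\<close>

lemma web_switch_matching:
  assumes m: "m \<in> matchings n" and i: "p < i" "i + 1 < q"
    and arcs: "{p, i} \<in> m" "{i + 1, q} \<in> m"
  shows "web_switch i m \<in> matchings n"
    and "left_endpoints (web_switch i m) = insert i (left_endpoints m - {i + 1})"
proof -
  have ne: "{p, i} \<noteq> {i + 1, q}"
    using i by (auto simp: doubleton_eq_iff)
  have r: "{i, i + 1} \<union> {p, q} = {p, i} \<union> {i + 1, q}" "{i, i + 1} \<inter> {p, q} = {}"
    "card {i, i + 1} = 2" "card {p, q} = 2"
    using i by auto
  show "web_switch i m \<in> matchings n"
    unfolding web_switch_eq[OF m arcs] by (rule matching_rewire(1)[OF m arcs r])
  have "p \<in> left_endpoints m"
    using mem_left_endpoints[OF m arcs(1)] i by simp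
  then show "left_endpoints (web_switch i m) = insert i (left_endpoints m - {i + 1})"
    unfolding web_switch_eq[OF m arcs] left_endpoints_rewire[OF m arcs ne r]
    using i by (auto simp: Min_Max_arc)
qed

text \<open>The new short arc joins neighbours and crosses nothing. An old arc crossing
  \<open>{p, q}\<close> has one end strictly between \<open>p\<close> and \<open>q\<close>, so it
  would already have crossed \<open>{p, i}\<close> or \<open>{i + 1, q}\<close>.\<close>

lemma web_switch_cup:
  assumes w: "w \<in> cup_diagrams n" and i: "p < i" "i + 1 < q"
    and arcs: "{p, i} \<in> w" "{i + 1, q} \<in> w"
  shows "web_switch i w \<in> cup_diagrams n"
proof -
  have m: "w \<in> matchings n"
    and nc: "\<And>a b c d. a < b \<Longrightarrow> b < c \<Longrightarrow> c < d \<Longrightarrow> {a, c} \<in> w \<Longrightarrow> {b, d} \<in> w \<Longrightarrow> False"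
    using w by (auto simp: cup_diagrams_eq)
  let ?E = "{{p, i}, {i + 1, q}}"
  have other: "x \<noteq> i" "x \<noteq> i + 1" "y \<noteq> i" "y \<noteq> i + 1" "{x, y} \<in> w" if "{x, y} \<in> w - ?E" for x y
    using that arc_disjoint[OF m _ arcs(1), of "{x, y}" i]
      arc_disjoint[OF m _ arcs(2), of "{x, y}" "i + 1"]
    by auto
  have False if ab: "a < b" "b < c" "c < d"
    and in1: "{a, c} \<in> web_switch i w" and in2: "{b, d} \<in> web_switch i w"
    for a b c d
  proof -
    have "{a, c} \<noteq> {i, i + 1}" "{b, d} \<noteq> {i, i + 1}"
      using ab by (auto simp: doubleton_eq_iff)
    then have c1: "{a, c} \<in> w - ?E \<or> {a, c} = {p, q}"
      and c2: "{b, d} \<in> w - ?E \<or> {b, d} = {p, q}"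
      using in1 in2 unfolding web_switch_eq[OF m arcs] by (metis Un_iff insert_iff empty_iff)+
    from c1 c2 show False
    proof (elim disjE)
      assume "{a, c} \<in> w - ?E" "{b, d} \<in> w - ?E"
      then show False using nc[OF ab] by simp
    next
      assume "{a, c} = {p, q}" and bd: "{b, d} \<in> w - ?E"
      then have "a = p" "c = q"
        using ab i by (auto simp: doubleton_eq_iff)
      then show False
        using nc[of p b i d] nc[of "i + 1" b q d] other[OF bd] arcs ab i by linarith
    next
      assume ac: "{a, c} \<in> w - ?E" and "{b, d} = {p, q}"
      then have "b = p" "d = q"
        using ab i by (auto simp: doubleton_eq_iff)
      then show False
        using nc[of a p c i] nc[of a "i + 1" c q] other[OF ac] arcs ab i by linarith
    next
      assume "{a, c} = {p, q}" "{b, d} = {p, q}"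
      then show False using ab by (auto simp: doubleton_eq_iff)
    qed
  qed
  then show ?thesis
    using web_switch_matching(1)[OF m i arcs] by (auto simp: cup_diagrams_eq)
qed

text \<open>Each arc joins neighbours, which leaves no room for the middle point of a
  crossing.\<close>

lemma columns_T0: "columns n (T0 n) \<in> cup_diagrams n"
proof -
  have "False" if abc: "a < b" "b < c" "{a, c} \<in> columns n (T0 n)" for a b c
  proof -
    obtain j where "j < n" "{a, c} = {fst (T0 n) ! j, snd (T0 n) ! j}"
      using abc(3) unfolding columns_def by blast
    then show False
      using abc(1,2) by (auto simp: T0_def doubleton_eq_iff)
  qed
  then show ?thesis
    using columns_matching[of "T0 n" n] T0_standard[of n]
    by (auto simp: cup_diagrams_eq standard_tableaux_def)
qed

section \<open>Coefficients of the isomorphism\<close>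

locale web_isomorphism =
  fixes n :: nat
    and act :: "(nat \<Rightarrow> nat) \<Rightarrow> (web \<Rightarrow> complex) \<Rightarrow> (web \<Rightarrow> complex)"
    and \<rho> :: "(tabloid \<Rightarrow> complex) \<Rightarrow> (web \<Rightarrow> complex)"
  assumes action: "web_action n act"
    and iso: "sym_module_iso (2 * n) (specht n) specht_act (web_module n) act \<rho>"
    and base: "\<rho> (polytabloid n (T0 n)) = delta (tab_web n (T0 n))"
begin

text \<open>Defined for all matchings, because resolving a crossing of the columns of a standard
  tableau need not give the columns of another one.\<close>

definition coef :: "web \<Rightarrow> web \<Rightarrow> complex" where
  "coef m w = \<rho> (matching_poly n m) w"

lemma rho_add:
  assumes "m \<in> matchings n" "m' \<in> matchings n"
  shows "\<rho> (matching_poly n m + matching_poly n m') =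
    \<rho> (matching_poly n m) + \<rho> (matching_poly n m')"
  using iso matching_poly_specht assms by (auto simp: sym_module_iso_def linear_between_def)

lemma coef_crossing:
  assumes m: "m \<in> matchings n" and ab: "a < b" "b < c" "c < d"
    and arcs: "{a, c} \<in> m" "{b, d} \<in> m"
  shows "coef m w =
    coef ((m - {{a, c}, {b, d}}) \<union> {{a, b}, {c, d}}) w +
    coef ((m - {{a, c}, {b, d}}) \<union> {{a, d}, {b, c}}) w"
proof -
  have "(m - {{a, c}, {b, d}}) \<union> {{a, b}, {c, d}} \<in> matchings n"
    "(m - {{a, c}, {b, d}}) \<union> {{a, d}, {b, c}} \<in> matchings n"
    using ab by (intro matching_rewire(1)[OF m arcs]; auto)+
  from rho_add[OF this] show ?thesis
    using matching_poly_crossing[OF m ab arcs] by (simp only: coef_def plus_fun_def)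
qed

text \<open>The first form computes in the web module and identifies the images of cup diagrams; the
  second starts in the Specht module and follows edges between tableaux.\<close>

lemma act_matching_poly:
  assumes m: "m \<in> matchings n" and i: "p < i" "i + 1 < q"
    and arcs: "{p, i} \<in> m" "{i + 1, q} \<in> m"
  shows "act (simple_transp i) (\<rho> (matching_poly n m)) =
    \<rho> (matching_poly n m) + \<rho> (matching_poly n (web_switch i m))"
    and "\<rho> (specht_act (simple_transp i) (matching_poly n m)) =
    \<rho> (matching_poly n m) + \<rho> (matching_poly n (web_switch i m))"
proof -
  have "simple_transp i permutes {1..2 * n}"
    using arc_range[OF m arcs(1)] arc_range[OF m arcs(2)] by (intro permutes_swap_id) auto
  then have *: "\<rho> (specht_act (simple_transp i) (matching_poly n m)) =
      act (simple_transp i) (\<rho> (matching_poly n m))"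
    using iso matching_poly_specht[OF m] by (simp add: sym_module_iso_def)
  show "\<rho> (specht_act (simple_transp i) (matching_poly n m)) =
    \<rho> (matching_poly n m) + \<rho> (matching_poly n (web_switch i m))"
    unfolding specht_act_matching_poly[OF m i arcs]
    by (rule rho_add[OF m web_switch_matching(1)[OF m i arcs]])
  with * show "act (simple_transp i) (\<rho> (matching_poly n m)) =
    \<rho> (matching_poly n m) + \<rho> (matching_poly n (web_switch i m))"
    by simp
qed

lemma descent_arcs:
  assumes m: "m \<in> matchings n" and i: "i \<notin> left_endpoints m" "i + 1 \<in> left_endpoints m"
    and rng: "i \<in> {1..2 * n}"
  obtains p q where "p < i" "i + 1 < q" "{p, i} \<in> m" "{i + 1, q} \<in> m"
proof -
  obtain p where p: "{i, p} \<in> m"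
    using arc_exists[OF m rng] .
  have "p < i"
    using mem_left_endpoints[OF m p] i(1) arc_range(3)[OF m p] by simp
  moreover obtain q where q: "{i + 1, q} \<in> m"
    using arc_exists[OF m, of "i + 1"] left_endpoints_subset[OF m] i(2) by blast
  moreover have "i + 1 < q"
    using mem_left_endpoints[OF m q] i(2) by simp
  ultimately show ?thesis
    using that p by (metis insert_commute)
qed

lemma graph_edge:
  assumes "(T, R) \<in> tableau_graph n"
  obtains i where "T \<in> standard_tableaux n" "R \<in> standard_tableaux n" "i \<in> {1..2 * n - 1}"
    "i \<notin> set (fst T)" "i + 1 \<in> set (fst T)" "R = tab_act (simple_transp i) T"
    "set (fst R) = insert i (set (fst T) - {i + 1})"
proof -
  obtain i where i: "T \<in> standard_tableaux n" "R \<in> standard_tableaux n" "i \<in> {1..2 * n - 1}"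
    "i \<in> set (snd T)" "i + 1 \<in> set (fst T)" "R = tab_act (simple_transp i) T"
    using assms by (auto simp: tableau_graph_def)
  moreover have "i \<notin> set (fst T)"
    using i(1,4) tableau_rows(3)[of T n] by (auto simp: standard_tableaux_def)
  ultimately show ?thesis
    using that standard_tableau_swap(2)[OF i(1,4,5)] by metis
qed

text \<open>The transposition acts on \<open>delta w\<close> in two ways: by the web rule, and by
  transport from the Specht module. Cancelling \<open>delta w\<close> gives the claim for the
  switched web.\<close>

lemma rho_cup_step:
  assumes edge: "(T, R) \<in> tableau_graph n"
    and w: "w \<in> cup_diagrams n" "left_endpoints w = set (fst T)" "\<rho> (matching_poly n w) = delta w"
  shows "\<exists>w' \<in> cup_diagrams n. left_endpoints w' = set (fst R) \<and> \<rho> (matching_poly n w') = delta w'"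
proof -
  obtain i where i: "i \<in> {1..2 * n - 1}" "i \<notin> set (fst T)" "i + 1 \<in> set (fst T)"
    and row: "set (fst R) = insert i (set (fst T) - {i + 1})"
    using graph_edge[OF edge] by metis
  have m: "w \<in> matchings n"
    using w(1) by (simp add: cup_diagrams_eq)
  obtain p q where pq: "p < i" "i + 1 < q" "{p, i} \<in> w" "{i + 1, q} \<in> w"
    by (rule descent_arcs[OF m, of i]) (use i w(2) in auto)
  \<comment> \<open>Selects the second case of the web rule: \<open>i\<close> is already joined to
    \<open>p\<close>.\<close>
  have "{i, i + 1} \<notin> w"
    using arc_unique[OF m, of i p "i + 1"] pq by (auto simp: insert_commute)
  then have "act (simple_transp i) (delta w) = delta w + delta (web_switch i w)"
    using action i(1) w(1) by (simp add: web_action_def)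
  moreover have "act (simple_transp i) (delta w) = delta w + \<rho> (matching_poly n (web_switch i w))"
    using act_matching_poly(1)[OF m pq] w(3) by simp
  ultimately have "\<rho> (matching_poly n (web_switch i w)) = delta (web_switch i w)"
    by simp
  then show ?thesis
    using web_switch_cup[OF w(1) pq] web_switch_matching(2)[OF m pq] w(2) row by auto
qed

text \<open>The left end points form a ballot path, hence one above that of \<open>T0\<close>, so a
  directed path from \<open>T0\<close> leads to a cup diagram with these left end points, and that
  is \<open>w\<close>.\<close>

lemma rho_cup:
  assumes w: "w \<in> cup_diagrams n"
  shows "\<rho> (matching_poly n w) = delta w"
proof -
  have m: "w \<in> matchings n"
    using w by (simp add: cup_diagrams_eq)
  obtain T where T: "set (fst T) = left_endpoints w" "tableau_le n (T0 n) T"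
    using tableau_le_if_height_le[OF T0_standard ballot_left_endpoints[OF m]
      height_T0_le[OF ballot_left_endpoints[OF m]]] by blast
  have "(T0 n, T) \<in> (tableau_graph n)\<^sup>*"
    using T(2) by (simp add: tableau_le_def)
  then have "\<exists>w' \<in> cup_diagrams n. left_endpoints w' = set (fst T) \<and> \<rho> (matching_poly n w') = delta w'"
  proof (induction rule: rtrancl_induct)
    case base
    have inc: "column_increasing n (T0 n)"
      using T0_standard by (rule standard_column_increasing)
    have "tab_web n (T0 n) = columns n (T0 n)"
      using columns_T0 left_endpoints_columns[OF inc] by (rule tab_web_eq)
    then show ?case
      using web_isomorphism.base[OF web_isomorphism_axioms] columns_T0 left_endpoints_columns[OF inc]
      by (auto simp: polytabloid_columns[OF inc])
  next
    case (step S R)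
    then show ?case
      using rho_cup_step by blast
  qed
  then show ?thesis
    using cup_diagram_eqI[OF w] T(1) by metis
qed

text \<open>Induction on the total arc weight. The positive coefficient is inherited from
  \<open>?m2\<close>, and nonnegativity for \<open>?m1\<close> excludes cancellation.\<close>

lemma coef_properties:
  assumes "m \<in> matchings n"
  shows "(\<forall>w. 0 \<le> coef m w \<and> (coef m w \<noteq> 0 \<longrightarrow>
      (\<forall>k. height (left_endpoints w) k \<le> height (left_endpoints m) k))) \<and>
    (\<exists>w \<in> cup_diagrams n. left_endpoints w = left_endpoints m \<and> 0 < coef m w)"
  using assms
proof (induction "sum (arc_weight n) m" arbitrary: m rule: less_induct)
  case (less m)
  note m = less.prems
  show ?case
  proof (cases "m \<in> cup_diagrams n")
    case True
    \<comment> \<open>The order on \<open>complex\<close> compares real parts and requires equal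
      imaginary parts; the values here are 0 and 1.\<close>
    then show ?thesis
      by (auto simp: coef_def rho_cup delta_def less_eq_complex_def less_complex_def)
  next
    case False
    then obtain a b c d where ab: "a < b" "b < c" "c < d" and arcs: "{a, c} \<in> m" "{b, d} \<in> m"
      using m by (auto simp: cup_diagrams_eq)
    let ?m1 = "(m - {{a, c}, {b, d}}) \<union> {{a, b}, {c, d}}"
    let ?m2 = "(m - {{a, c}, {b, d}}) \<union> {{a, d}, {b, c}}"
    have ne: "{a, c} \<noteq> {b, d}"
      using ab by (auto simp: doubleton_eq_iff)
    have r: "{a, b} \<union> {c, d} = {a, c} \<union> {b, d}" "{a, b} \<inter> {c, d} = {}"
      "card {a, b} = 2" "card {c, d} = 2"
      "{a, d} \<union> {b, c} = {a, c} \<union> {b, d}" "{a, d} \<inter> {b, c} = {}"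
      "card {a, d} = 2" "card {b, c} = 2"
      using ab by auto
    note c1 = matching_rewire[OF m arcs r(1-4)] and c2 = matching_rewire[OF m arcs r(5-8)]
    have d: "d \<le> 2 * n"
      using arc_range(2)[OF m arcs(2)] by simp
    have "sum (arc_weight n) ?m1 < sum (arc_weight n) m" "sum (arc_weight n) ?m2 < sum (arc_weight n) m"
      unfolding sum.rewire(1)[OF finite_matching[OF m] arcs ne c1(2-4)]
        sum.rewire(2)[OF finite_matching[OF m] arcs ne c1(2-4)]
        sum.rewire(2)[OF finite_matching[OF m] arcs ne c2(2-4)]
      using arc_weight_resolve[OF ab d] by simp_all
    note IH1 = less.hyps[OF this(1) c1(1)] and IH2 = less.hyps[OF this(2) c2(1)]
    have mem: "a \<in> left_endpoints m" "b \<in> left_endpoints m"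
      using mem_left_endpoints[OF m arcs(1)] mem_left_endpoints[OF m arcs(2)] ab by auto
    \<comment> \<open>The left end point \<open>b\<close> moves right to \<open>c\<close>, which
      lowers the path.\<close>
    have "left_endpoints ?m1 = (left_endpoints m - {a, b}) \<union> {a, c}"
      unfolding left_endpoints_rewire[OF m arcs ne r(1-4)]
      by (simp only: Min_Max_arc[OF ab(1)] Min_Max_arc[OF ab(3)]
        Min_Max_arc[OF less_trans[OF ab(1,2)]] Min_Max_arc[OF less_trans[OF ab(2,3)]])
    then have le1: "height (left_endpoints ?m1) k \<le> height (left_endpoints m) k" for k
      using mem ab by (intro height_replace_le[of b _ c]) auto
    \<comment> \<open>The nested resolution keeps both left end points, hence the path.\<close>
    have "left_endpoints ?m2 = (left_endpoints m - {a, b}) \<union> {a, b}"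
      unfolding left_endpoints_rewire[OF m arcs ne r(5-8)] using ab by (simp add: Min_Max_arc)
    then have le2: "left_endpoints ?m2 = left_endpoints m"
      using mem by auto
    have eq: "coef m w = coef ?m1 w + coef ?m2 w" for w
      by (rule coef_crossing[OF m ab arcs])
    have "0 \<le> coef m w" for w
      using IH1 IH2 by (simp only: eq add_nonneg_nonneg)
    moreover have "height (left_endpoints w) k \<le> height (left_endpoints m) k" if "coef m w \<noteq> 0" for w k
    proof -
      have "coef ?m1 w \<noteq> 0 \<or> coef ?m2 w \<noteq> 0"
        using that by (auto simp: eq)
      then show ?thesis
      proof
        assume "coef ?m1 w \<noteq> 0"
        then have "height (left_endpoints w) k \<le> height (left_endpoints ?m1) k"
          using IH1 by blast
        then show ?thesis
          using le1[of k] by (rule order_trans)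
      next
        assume "coef ?m2 w \<noteq> 0"
        then show ?thesis
          using IH2 unfolding le2 by blast
      qed
    qed
    moreover have "\<exists>w \<in> cup_diagrams n. left_endpoints w = left_endpoints m \<and> 0 < coef m w"
    proof -
      obtain w where w: "w \<in> cup_diagrams n" "left_endpoints w = left_endpoints m" "0 < coef ?m2 w"
        using IH2 le2 by auto
      moreover have "0 < coef m w"
        unfolding eq using IH1 w(3) by (intro add_nonneg_pos) auto
      ultimately show ?thesis
        by blast
    qed
    ultimately show ?thesis
      by blast
  qed
qed

text \<open>The extra term belongs to the switched column matching, which may have crossings; this
  is why nonnegativity is proved for all matchings.\<close>

lemma coef_edge:
  assumes edge: "(T, R) \<in> tableau_graph n"
  shows "coef (columns n T) w \<le> coef (columns n R) w"
proof -
  obtain i where T: "T \<in> standard_tableaux n" and R: "R \<in> standard_tableaux n"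
    and i: "i \<in> {1..2 * n - 1}" "i \<notin> set (fst T)" "i + 1 \<in> set (fst T)"
    and R_eq: "R = tab_act (simple_transp i) T"
    using graph_edge[OF edge] by metis
  have T': "T \<in> tableaux n"
    using T by (simp add: standard_tableaux_def)
  note inc = standard_column_increasing[OF T] and incR = standard_column_increasing[OF R]
  note m = columns_matching[OF T']
  obtain p q where pq: "p < i" "i + 1 < q" "{p, i} \<in> columns n T" "{i + 1, q} \<in> columns n T"
    by (rule descent_arcs[OF m, of i]) (use i left_endpoints_columns[OF inc] in auto)
  have "simple_transp i permutes {1..2 * n}"
    using i(1) by (intro permutes_swap_id) auto
  then have "matching_poly n (columns n R) = specht_act (simple_transp i) (matching_poly n (columns n T))"
    using specht_act_polytabloid[OF T'] R_eq polytabloid_columns[OF inc] polytabloid_columns[OF incR]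
    by metis
  then have "coef (columns n R) w = coef (columns n T) w + coef (web_switch i (columns n T)) w"
    using act_matching_poly(2)[OF m pq] by (simp add: coef_def)
  then show ?thesis
    using coef_properties[OF web_switch_matching(1)[OF m pq]] by simp
qed

lemma coef_tableau_le:
  assumes "tableau_le n S T"
  shows "coef (columns n S) w \<le> coef (columns n T) w"
proof -
  have "(S, T) \<in> (tableau_graph n)\<^sup>*"
    using assms by (simp add: tableau_le_def)
  then show ?thesis
    by (induction rule: rtrancl_induct) (auto intro: order_trans coef_edge)
qed

text \<open>That a cup diagram with the prescribed left end points exists is read off from
  \<open>coef_properties\<close> for the column matching.\<close>

lemma tab_web_standard:
  assumes S: "S \<in> standard_tableaux n"
  shows "left_endpoints (tab_web n S) = set (fst S)" "0 < coef (columns n S) (tab_web n S)"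
proof -
  note inc = standard_column_increasing[OF S]
  have "columns n S \<in> matchings n"
    using inc by (simp add: column_increasing_def columns_matching)
  then obtain w where w: "w \<in> cup_diagrams n" "left_endpoints w = set (fst S)" "0 < coef (columns n S) w"
    using coef_properties left_endpoints_columns[OF inc] by metis
  then show "left_endpoints (tab_web n S) = set (fst S)" "0 < coef (columns n S) (tab_web n S)"
    using tab_web_eq[OF w(1,2)] by auto
qed

lemma coef_pos_iff:
  assumes S: "S \<in> standard_tableaux n" and T: "T \<in> standard_tableaux n"
  shows "0 < coef (columns n T) (tab_web n S) \<longleftrightarrow> tableau_le n S T"
proof
  assume pos: "0 < coef (columns n T) (tab_web n S)"
  note inc = standard_column_increasing[OF T]
  have "columns n T \<in> matchings n"
    using inc by (simp add: column_increasing_def columns_matching)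
  moreover have "coef (columns n T) (tab_web n S) \<noteq> 0"
    using pos by auto
  ultimately have "height (set (fst S)) k \<le> height (set (fst T)) k" for k
    using coef_properties tab_web_standard(1)[OF S] left_endpoints_columns[OF inc] by metis
  \<comment> \<open>Raising the path of \<open>S\<close> ends at a tableau with the first row of
    \<open>T\<close>, which is then \<open>T\<close> itself.\<close>
  then obtain T' where "T' \<in> standard_tableaux n" "set (fst T') = set (fst T)" "tableau_le n S T'"
    using tableau_le_if_height_le[OF S ballot_first_row[OF T]] by blast
  then show "tableau_le n S T"
    using standard_tableau_eqI[OF _ T] by metis
next
  assume "tableau_le n S T"
  then show "0 < coef (columns n T) (tab_web n S)"
    using tab_web_standard(2)[OF S] coef_tableau_le less_le_trans by blast
qed

text \<open>Webs of distinct standard tableaux have distinct left end points, so evaluating the sum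
  at \<open>tab_web n S\<close> isolates one coefficient.\<close>

lemma coef_expansion:
  assumes a: "\<rho> (polytabloid n T) =
      (\<Sum>S\<in>standard_tableaux n. cscale (a S) (delta (tab_web n S)))"
    and S: "S \<in> standard_tableaux n" and T: "T \<in> standard_tableaux n"
  shows "a S = coef (columns n T) (tab_web n S)"
proof -
  have "coef (columns n T) (tab_web n S) =
      (\<Sum>R\<in>standard_tableaux n. a R * delta (tab_web n R) (tab_web n S))"
    using a by (simp add: coef_def polytabloid_columns[OF standard_column_increasing[OF T]]
      sum_fun_apply cscale_def)
  also have "\<dots> = (\<Sum>R\<in>standard_tableaux n. if R = S then a R else 0)"
  proof (rule sum.cong[OF refl])
    fix R assume R: "R \<in> standard_tableaux n"
    have "tab_web n S = tab_web n R \<longleftrightarrow> R = S"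
      using standard_tableau_eqI[OF R S] tab_web_standard(1)[OF R] tab_web_standard(1)[OF S] by metis
    then show "a R * delta (tab_web n R) (tab_web n S) = (if R = S then a R else 0)"
      by (simp add: delta_def)
  qed
  also have "\<dots> = a S"
    using S by (simp add: finite_standard_tableaux)
  finally show ?thesis ..
qed

end

theorem theorem1p1:
  fixes n :: nat
    and act :: "(nat \<Rightarrow> nat) \<Rightarrow> (web \<Rightarrow> complex) \<Rightarrow> (web \<Rightarrow> complex)"
    and \<rho> :: "(tabloid \<Rightarrow> complex) \<Rightarrow> (web \<Rightarrow> complex)"
    and a :: "tableau \<Rightarrow> tableau \<Rightarrow> complex"
  assumes "n \<ge> 1"
    and "web_action n act"
    and "sym_module_iso (2 * n) (specht n) specht_act (web_module n) act \<rho>"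
    and "\<rho> (polytabloid n (T0 n)) = delta (tab_web n (T0 n))"
    and "\<And>T. T \<in> standard_tableaux n \<Longrightarrow>
           \<rho> (polytabloid n T) =
             (\<Sum>S\<in>standard_tableaux n. cscale (a S T) (delta (tab_web n S)))"
  shows "\<forall>S\<in>standard_tableaux n. \<forall>T\<in>standard_tableaux n. a S T > 0 \<longleftrightarrow> tableau_le n S T"
proof (intro ballI)
  interpret web_isomorphism n act \<rho>
    using assms(2-4) by unfold_locales
  fix S T assume S: "S \<in> standard_tableaux n" and T: "T \<in> standard_tableaux n"
  have "a S T = coef (columns n T) (tab_web n S)"
    using coef_expansion[OF assms(5)[OF T] S T] .
  then show "a S T > 0 \<longleftrightarrow> tableau_le n S T"
    using coef_pos_iff[OF S T] by simp
qed

end
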